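(* Let $T$ be a tree poset of height $k+1$ that contains a maximal element $m$ such that every chain of $k+1$ elements in $T$ contains $m$. Then for any real $\varepsilon>0$ there exists $n_0=n_0(\varepsilon)$ such that if $n\ge n_0$ and $\mathcal{F}\subseteq\tilde{B}_n$ with $|\mathcal{F}|=(k-1+\varepsilon)\binom{n}{\lfloor n/2\rfloor}$, then $\mathcal{F}$ contains a strong copy $\mathcal{G}$ of $T\setminus\{m\}$, given by a bijection $p\mapsto G_p$, such that for every $p\in T\setminus\mathcal{D}_T(m)$ the set $G_p$ is not a subset of $\bigcup_{d\in\mathcal{D}_T(m)\setminus\{m\}}G_d$.
   Context: $[n]=\{1,\dots,n\}$ and $\tilde{B}_n=\{F\subseteq[n]: ||F|-n/2|\le 2\sqrt{n\ln n}\}$. A family $\mathcal{G}$ is a strong copy of a poset $(P,\leqslant)$ if there is a bijection $f:P\to\mathcal{G}$ with $p\leqslant q\iff f(p)\subseteq f(q)$; we write $G_p=f(p)$. $T\setminus\{m\}$ carries the induced order. $\mathcal{D}_T(m)=\{q\in T: q\leqslant m\}$. The height of a poset is the maximum number of elements of a chain in it. The Hasse diagram of a poset is the graph where $p,q$ are adjacent if one covers the other; a tree poset is one whose Hasse diagram is a tree. *)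

theory Defs
  imports Complex_Main
begin

text \<open>A poset is a carrier set \<open>P\<close> together with a relation \<open>r\<close> such that \<^term>\<open>partial_order_on P r\<close>;
  \<open>(p, q) \<in> r\<close> means \<open>p \<le> q\<close>. The order induced on a subset \<open>Q\<close> is \<open>Restr r Q\<close>.\<close>

definition covers :: "'a rel \<Rightarrow> 'a rel" where
  "covers r = {(p, q). (p, q) \<in> r \<and> p \<noteq> q \<and> \<not> (\<exists>x. (p, x) \<in> r \<and> (x, q) \<in> r \<and> x \<noteq> p \<and> x \<noteq> q)}"

definition hasse :: "'a rel \<Rightarrow> 'a rel" where
  "hasse r = covers r \<union> (covers r)\<inverse>"

text \<open>An undirected simple graph is given by its vertex set \<open>V\<close> and its adjacency relation \<open>E\<close>,
  a symmetric and irreflexive relation on \<open>V\<close>. The predicate \<open>tree\<close> of the AFP entry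
  \<open>Graph_Theory\<close> is not used: it excludes directed cycles, hence also closed walks \<open>a, b, a\<close>.\<close>

definition graph_cycle :: "'a rel \<Rightarrow> 'a list \<Rightarrow> bool" where
  "graph_cycle E xs \<longleftrightarrow> 3 \<le> length xs \<and> distinct xs
     \<and> successively (\<lambda>x y. (x, y) \<in> E) xs \<and> (last xs, hd xs) \<in> E"

definition is_tree :: "'a set \<Rightarrow> 'a rel \<Rightarrow> bool" where
  "is_tree V E \<longleftrightarrow> V \<noteq> {} \<and> (\<forall>u\<in>V. \<forall>v\<in>V. (u, v) \<in> E\<^sup>*) \<and> \<not> (\<exists>xs. graph_cycle E xs)"

definition tree_poset :: "'a set \<Rightarrow> 'a rel \<Rightarrow> bool" where
  "tree_poset P r \<longleftrightarrow> finite P \<and> partial_order_on P r \<and> is_tree P (hasse r)"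

text \<open>If \<^term>\<open>partial_order_on P r\<close>, then every member of \<^term>\<open>Chains r\<close> is a subset of \<open>P\<close>,
  because \<open>Chains\<close> also compares each element with itself.\<close>

definition height :: "'a rel \<Rightarrow> nat" where
  "height r = Max (card ` Chains r)"

definition maximal_in :: "'a set \<Rightarrow> 'a rel \<Rightarrow> 'a \<Rightarrow> bool" where
  "maximal_in P r m \<longleftrightarrow> m \<in> P \<and> (\<forall>q\<in>P. (m, q) \<in> r \<longrightarrow> q = m)"

definition down_set :: "'a set \<Rightarrow> 'a rel \<Rightarrow> 'a \<Rightarrow> 'a set" where
  "down_set P r m = {q \<in> P. (q, m) \<in> r}"

definition middle_layers :: "nat \<Rightarrow> nat set set" where
  "middle_layers n =
     {F. F \<subseteq> {1..n} \<and> \<bar>real (card F) - real n / 2\<bar> \<le> 2 * sqrt (real n * ln (real n))}"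

definition strong_copy :: "('a \<Rightarrow> nat set) \<Rightarrow> 'a set \<Rightarrow> 'a rel \<Rightarrow> nat set set \<Rightarrow> bool" where
  "strong_copy f P r \<G> \<longleftrightarrow>
     bij_betw f P \<G> \<and> (\<forall>p\<in>P. \<forall>q\<in>P. (p, q) \<in> r \<longleftrightarrow> f p \<subseteq> f q)"

end

theory Submission
  imports Defs "HOL-Combinatorics.Permutations" "HOL-Real_Asymp.Real_Asymp"
begin

text \<open>
  Rank the elements of \<open>T - {m}\<close> strictly monotonically by \<open>1, \<dots>, k\<close>. Among all pairs of a set in
  \<open>\<F>\<close> and a rank, discard repeatedly a pair \<open>(A, j)\<close> for which some rank \<open>i \<noteq> j\<close> is met by a random
  maximal chain through \<open>A\<close>, on the correct side of \<open>A\<close>, with probability below \<open>\<delta>\<close>. If all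
  pairs were discarded, a random maximal chain would contain at most \<open>k - 1\<close> members of \<open>\<F>\<close> apart
  from a contribution of expectation at most \<open>k \<delta>\<close> times that of the number of members, which
  contradicts \<open>|\<F>| = (k - 1 + \<epsilon>) (n choose n div 2)\<close>. So a nonempty stable system survives.

  In a stable system \<open>T - {m}\<close> is embedded vertex by vertex: first the lower covers of \<open>m\<close>, all close
  to one common set, then the other vertices as leaves of the tree rooted at \<open>m\<close>. As all sets lie
  within \<open>O(sqrt (n ln n))\<close> of each other, a random chain leaving a set \<open>A\<close> creates an unwanted
  inclusion only with probability \<open>O(sqrt (ln n / n)) < \<delta>\<close>.
\<close>

section \<open>Leaves of trees and of tree posets\<close>

text \<open>A longest simple path ending in \<open>m\<close> starts at a leaf: any further neighbour
  of its first vertex would prolong the path or close a cycle. Off the star of \<open>m\<close> such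
  a path has at least three vertices, so neither the leaf nor its neighbour is \<open>m\<close>.
  This lets a tree be stripped down to the star of \<open>m\<close> leaf by leaf.\<close>

lemma is_tree_leaf_off_star:
  assumes fin: "finite V" and sub: "E \<subseteq> V \<times> V" and sy: "sym E" and irr: "irrefl E"
    and tree: "is_tree V E" and m: "m \<in> V" and nstar: "V \<noteq> insert m (E `` {m})"
  obtains l a where "l \<in> V" "l \<noteq> m" "a \<in> V" "a \<noteq> m" "a \<noteq> l" "E `` {l} = {a}"
proof -
  define paths where "paths = {xs. set xs \<subseteq> V \<and> distinct xs \<and>
    successively (\<lambda>x y. (x, y) \<in> E) xs \<and> xs \<noteq> [] \<and> last xs = m}"
  have finp: "finite paths"
    by (rule finite_subset[OF _ finite_subset_distinct[OF fin]]) (auto simp: paths_def)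
  define S where "S = insert m (E `` {m})"
  have "S \<subseteq> V" using sub m by (auto simp: S_def)
  with nstar obtain v where v: "v \<in> V" "v \<notin> S" by (auto simp: S_def)
  have "(m, v) \<in> E\<^sup>*" using tree m v(1) by (auto simp: is_tree_def)
  \<comment> \<open>A walk from \<open>m\<close> to \<open>v\<close> has to leave \<open>S\<close>
    along some edge. Its inner end \<open>c\<close> is not \<open>m\<close>, since all neighbours of
    \<open>m\<close> lie in \<open>S\<close>; hence \<open>x, c, m\<close> is a simple path.\<close>
  then have "\<exists>c x. c \<in> S \<and> x \<notin> S \<and> (c, x) \<in> E" using v(2)
  proof (induction rule: rtrancl_induct)
    case base
    then show ?case by (auto simp: S_def)
  next
    case (step y z)
    then show ?case by (cases "y \<in> S") auto
  qed
  then obtain c x where cx: "c \<in> S" "x \<notin> S" "(c, x) \<in> E" by blast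
  have c: "(m, c) \<in> E" "c \<noteq> m" using cx by (auto simp: S_def)
  have p3: "[x, c, m] \<in> paths"
    using cx c sub m symD[OF sy cx(3)] symD[OF sy c(1)] by (auto simp: paths_def S_def)
  have "Max (length ` paths) \<in> length ` paths"
    using finp p3 by (intro Max_in) auto
  then obtain xs where "xs \<in> paths" "length xs = Max (length ` paths)"
    by auto
  then have xs: "xs \<in> paths" "\<And>ys. ys \<in> paths \<Longrightarrow> length ys \<le> length xs"
    using finp by auto
  have "3 \<le> length xs" using xs(2)[OF p3] by simp
  then obtain l a b rest where xs_eq: "xs = l # a # b # rest"
    by (auto simp: numeral_3_eq_3 Suc_le_length_iff)
  have path: "set xs \<subseteq> V" "distinct xs" "successively (\<lambda>x y. (x, y) \<in> E) xs" "last xs = m"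
    using xs(1) by (auto simp: paths_def)
  have am: "a \<noteq> m" "l \<noteq> m"
    using path xs_eq by (auto split: if_splits)
  have "y = a" if y: "(l, y) \<in> E" for y
  proof (rule ccontr)
    assume ya: "y \<noteq> a"
    have yl: "y \<noteq> l" using y irr by (auto simp: irrefl_def)
    have yV: "y \<in> V" using y sub by auto
    show False
    proof (cases "y \<in> set xs")
      case False
      then have "y # xs \<in> paths"
        using path symD[OF sy y] yV xs_eq by (simp add: paths_def)
      with xs(2)[of "y # xs"] show False by simp
    next
      case True
      \<comment> \<open>The segment of the path from \<open>l\<close> to \<open>y\<close> has at
        least three vertices because \<open>y\<close> is not \<open>a\<close>, and the edge between
        \<open>y\<close> and \<open>l\<close> closes it to a cycle.\<close>
      then obtain us vs where uv: "xs = us @ y # vs" by (meson split_list)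
      then obtain us' where us: "us = l # a # us'"
        using ya yl xs_eq by (cases us; cases "tl us") auto
      have "xs = (us @ [y]) @ vs" using uv by simp
      then have "successively (\<lambda>x y. (x, y) \<in> E) (us @ [y])" "distinct (us @ [y])"
        using path by (auto simp only: successively_append_iff distinct_append)
      then have "graph_cycle E (us @ [y])"
        using symD[OF sy y] us by (auto simp: graph_cycle_def)
      with tree show False by (auto simp: is_tree_def)
    qed
  qed
  moreover have "(l, a) \<in> E" using path xs_eq by auto
  ultimately have "E `` {l} = {a}" by blast
  moreover have "l \<in> V" "a \<in> V" "a \<noteq> l" using path xs_eq by auto
  ultimately show thesis using that am by blast
qed

section \<open>Cover relations, Hasse diagrams and deletion of a leaf\<close>

lemma sym_hasse: "sym (hasse r)"
  by (auto simp: hasse_def sym_def)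

lemma irrefl_hasse: "irrefl (hasse r)"
  by (auto simp: hasse_def irrefl_def covers_def)

lemma hasse_subset: "r \<subseteq> P \<times> P \<Longrightarrow> hasse r \<subseteq> P \<times> P"
  by (auto simp: hasse_def covers_def)

lemma covers_converse: "covers (r\<inverse>) = (covers r)\<inverse>"
  by (auto simp: covers_def)

lemma hasse_converse: "hasse (r\<inverse>) = hasse r"
  by (auto simp: hasse_def covers_converse)

text \<open>The cover is a minimal element of the set of all elements strictly above
  \<open>p\<close> and below or equal to \<open>q\<close>; finiteness makes the strict order
  well-founded.\<close>

lemma cover_above:
  assumes fin: "finite P" and po: "partial_order_on P r" and pq: "(p, q) \<in> r" "p \<noteq> q"
  obtains c where "(p, c) \<in> covers r" "(c, q) \<in> r"
proof -
  note po' = partial_order_onD[OF po]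
  have wf: "wf (r - Id)"
    by (rule partial_order_on_well_order_on[OF finite_subset[OF po'(4)] po]) (simp add: fin)
  have "q \<in> {x. (p, x) \<in> r \<and> p \<noteq> x \<and> (x, q) \<in> r}"
    using pq po' by (auto simp: refl_on_def)
  from wfE_min[OF wf this] obtain c where c: "(p, c) \<in> r" "p \<noteq> c" "(c, q) \<in> r"
    and min: "\<And>y. (y, c) \<in> r - Id \<Longrightarrow> y \<notin> {x. (p, x) \<in> r \<and> p \<noteq> x \<and> (x, q) \<in> r}"
    by blast
  have "(p, c) \<in> covers r"
    using c min po'(2) by (auto simp: covers_def dest: transD)
  with c show thesis by (intro that)
qed

lemma cover_below:
  assumes "finite P" "partial_order_on P r" "(p, q) \<in> r" "p \<noteq> q"
  obtains c where "(c, q) \<in> covers r" "(p, c) \<in> r"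
  using cover_above[of P "r\<inverse>" q p] assms by (auto simp: covers_converse)

lemma partial_order_on_Restr:
  "partial_order_on P r \<Longrightarrow> Q \<subseteq> P \<Longrightarrow> partial_order_on Q (Restr r Q)"
  by (auto simp: partial_order_on_def preorder_on_def refl_on_def antisym_def intro!: transI
      dest: transD)

text \<open>A new cover could only arise if \<open>l\<close> lay strictly between its two ends. Then
  \<open>l\<close> would have a cover above and a cover below, both equal to the single neighbour
  \<open>a\<close>, against antisymmetry.\<close>

lemma covers_Restr_leaf:
  assumes fin: "finite P" and po: "partial_order_on P r" and leaf: "hasse r `` {l} = {a}"
  shows "covers (Restr r (P - {l})) = Restr (covers r) (P - {l})"
proof
  note po' = partial_order_onD[OF po]
  show "Restr (covers r) (P - {l}) \<subseteq> covers (Restr r (P - {l}))"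
    by (auto simp: covers_def)
  show "covers (Restr r (P - {l})) \<subseteq> Restr (covers r) (P - {l})"
  proof clarify
    fix p q assume pq: "(p, q) \<in> covers (Restr r (P - {l}))"
    have "(p, q) \<in> covers r"
    proof (rule ccontr)
      assume "(p, q) \<notin> covers r"
      with pq obtain x where x: "(p, x) \<in> r" "(x, q) \<in> r" "x \<noteq> p" "x \<noteq> q"
        by (auto simp: covers_def)
      then have "x = l" using pq po'(4) by (auto simp: covers_def)
      with x obtain c d where c: "(l, c) \<in> covers r" "(c, q) \<in> r"
        and d: "(d, l) \<in> covers r" "(p, d) \<in> r"
        using cover_above[OF fin po, of l q] cover_below[OF fin po, of p l] by metis
      have "c = a" "d = a" using c d leaf by (auto simp: hasse_def)
      then show False using c d po'(3) by (auto simp: covers_def dest: antisymD)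
    qed
    with pq show "(p, q) \<in> covers r \<inter> (P - {l}) \<times> (P - {l})" by (auto simp: covers_def)
  qed
qed

lemma hasse_Restr_leaf:
  assumes "finite P" "partial_order_on P r" "hasse r `` {l} = {a}"
  shows "hasse (Restr r (P - {l})) = Restr (hasse r) (P - {l})"
  unfolding hasse_def using covers_Restr_leaf[OF assms] by auto

lemma tree_poset_remove_leaf:
  assumes tp: "tree_poset P r" and leaf: "hasse r `` {l} = {a}" and a: "a \<in> P" "a \<noteq> l"
  shows "tree_poset (P - {l}) (Restr r (P - {l}))"
proof -
  have fin: "finite P" and po: "partial_order_on P r" and tree: "is_tree P (hasse r)"
    using tp by (auto simp: tree_poset_def)
  let ?E = "hasse r" and ?E' = "Restr (hasse r) (P - {l})"
  \<comment> \<open>The retraction \<open>\<phi>\<close> folds the leaf onto its neighbour. It sends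
    each edge to an edge or a single point of the remaining graph, so connectedness
    survives.\<close>
  define \<phi> where "\<phi> x = (if x = l then a else x)" for x
  have step: "(\<phi> x, \<phi> y) \<in> ?E'\<^sup>*" if xy: "(x, y) \<in> ?E" for x y
  proof -
    have "(x, y) \<in> P \<times> P" using xy hasse_subset partial_order_onD(4)[OF po] by blast
    moreover have "x = l \<Longrightarrow> y = a" "y = l \<Longrightarrow> x = a"
      using xy leaf symD[OF sym_hasse xy] by blast+
    ultimately show ?thesis using xy a by (auto simp: \<phi>_def)
  qed
  have "(\<phi> u, \<phi> v) \<in> ?E'\<^sup>*" if "(u, v) \<in> ?E\<^sup>*" for u v
    using that by induction (auto dest: step)
  moreover have "(u, v) \<in> ?E\<^sup>*" if "u \<in> P" "v \<in> P" for u v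
    using tree that by (auto simp: is_tree_def)
  moreover have "\<phi> u = u" if "u \<in> P - {l}" for u
    using that by (auto simp: \<phi>_def)
  ultimately have conn: "(u, v) \<in> ?E'\<^sup>*" if "u \<in> P - {l}" "v \<in> P - {l}" for u v
    using that by (metis Diff_iff)
  have "graph_cycle ?E xs" if "graph_cycle ?E' xs" for xs
    using that unfolding graph_cycle_def
    by (auto elim!: successively_mono)
  then have "is_tree (P - {l}) ?E'"
    using tree a conn unfolding is_tree_def by blast
  then show ?thesis
    using fin po hasse_Restr_leaf[OF fin po leaf] partial_order_on_Restr[OF po]
    by (auto simp: tree_poset_def)
qed

text \<open>A leaf has only one cover relation, so all its comparabilities pass through
  \<open>a\<close>. When \<open>l\<close> is embedded, its required inclusions therefore follow from
  the one with the set of \<open>a\<close>.\<close>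

lemma leaf_above_neighbour:
  assumes fin: "finite P" and po: "partial_order_on P r" and leaf: "hasse r `` {l} = {a}"
    and cov: "(a, l) \<in> covers r" and q: "q \<noteq> l"
  shows "(q, l) \<in> r \<longleftrightarrow> (q, a) \<in> r" and "(l, q) \<notin> r"
proof -
  note po' = partial_order_onD[OF po]
  have al: "(a, l) \<in> r" "a \<noteq> l" using cov by (auto simp: covers_def)
  show "(q, l) \<in> r \<longleftrightarrow> (q, a) \<in> r"
  proof
    assume "(q, l) \<in> r"
    with q obtain c where "(c, l) \<in> covers r" "(q, c) \<in> r"
      using cover_below[OF fin po] by metis
    with leaf show "(q, a) \<in> r" by (auto simp: hasse_def)
  next
    assume "(q, a) \<in> r"
    with al po' show "(q, l) \<in> r" by (auto dest: transD)
  qed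
  show "(l, q) \<notin> r"
  proof
    assume "(l, q) \<in> r"
    with q obtain c where "(l, c) \<in> covers r"
      using cover_above[OF fin po] by metis
    with leaf have "(l, a) \<in> r" by (auto simp: hasse_def covers_def)
    with al po' show False by (auto dest: antisymD)
  qed
qed

lemma leaf_below_neighbour:
  assumes "finite P" "partial_order_on P r" "hasse r `` {l} = {a}" "(l, a) \<in> covers r" "q \<noteq> l"
  shows "(l, q) \<in> r \<longleftrightarrow> (a, q) \<in> r" and "(q, l) \<notin> r"
  using leaf_above_neighbour[of P "r\<inverse>" l a q] assms
  by (auto simp: covers_converse hasse_converse)

section \<open>Random maximal chains\<close>

text \<open>A permutation \<open>\<pi>\<close> of \<open>{1..n}\<close> stands for the maximal chain of the sets \<open>\<pi> ` {1..i}\<close>.\<close>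

definition through :: "nat \<Rightarrow> nat set \<Rightarrow> (nat \<Rightarrow> nat) set" where
  "through n A = {\<pi>. \<pi> permutes {1..n} \<and> \<pi> ` {1..card A} = A}"

lemma finite_through [simp]: "finite (through n A)"
  by (rule finite_subset[OF _ finite_permutations[of "{1..n}"]]) (auto simp: through_def)

lemma through_subset:
  assumes "\<pi> \<in> through n A" "\<pi> \<in> through n B" "card A \<le> card B"
  shows "A \<subseteq> B"
proof -
  have "\<pi> ` {1..card A} \<subseteq> \<pi> ` {1..card B}"
    using assms(3) by (intro image_mono) auto
  then show ?thesis using assms(1,2) by (simp add: through_def)
qed

lemma through_compose:
  assumes h: "h permutes {1..n}" "h ` A = B" and \<pi>: "\<pi> \<in> through n A"
  shows "h \<circ> \<pi> \<in> through n B"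
proof -
  have "card B = card A"
    using h permutes_inj[OF h(1)] by (metis card_image inj_on_subset subset_UNIV)
  moreover have "\<pi> permutes {1..n}" "\<pi> ` {1..card A} = A"
    using \<pi> by (auto simp: through_def)
  moreover have "(h \<circ> \<pi>) ` {1..card A} = h ` (\<pi> ` {1..card A})"
    by (simp only: image_comp)
  ultimately show ?thesis
    using h by (simp add: through_def permutes_compose del: image_comp o_apply)
qed

text \<open>A permutation \<open>h\<close> of the ground set that carries \<open>A\<close> to
  \<open>B\<close> acts by composition, injectively, from the chains through \<open>A\<close> to
  those through \<open>B\<close>.\<close>

lemma card_through_eq:
  assumes "A \<subseteq> {1..n}" "B \<subseteq> {1..n}" "card A = card B"
  shows "card (through n A) = card (through n B)"
proof -
  have le: "card (through n A) \<le> card (through n B)"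
    if AB: "A \<subseteq> {1..n}" "B \<subseteq> {1..n}" "card A = card B" for A B
  proof -
    have fin: "finite A" "finite B" using AB by (auto intro: finite_subset)
    have "card ({1..n} - A) = card ({1..n} - B)"
      using AB fin by (simp add: card_Diff_subset)
    then obtain f g where f: "bij_betw f A B" and g: "bij_betw g ({1..n} - A) ({1..n} - B)"
      using finite_same_card_bij fin AB(3) by (metis finite_Diff finite_atLeastAtMost)
    define h where "h x = (if x \<in> A then f x else if x \<in> {1..n} then g x else x)" for x
    have hA: "bij_betw h A B"
      using f by (subst bij_betw_cong[where g = f]) (auto simp: h_def)
    moreover have "bij_betw h ({1..n} - A) ({1..n} - B)"
      using g by (subst bij_betw_cong[where g = g]) (auto simp: h_def)
    ultimately have "bij_betw h (A \<union> ({1..n} - A)) (B \<union> ({1..n} - B))"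
      by (rule bij_betw_combine) auto
    then have hp: "h permutes {1..n}"
      using AB by (intro bij_imp_permutes) (auto simp: Un_absorb1 h_def subset_eq)
    have "(\<circ>) h ` through n A \<subseteq> through n B"
      using through_compose[OF hp bij_betw_imp_surj_on[OF hA]] by blast
    moreover have "inj_on ((\<circ>) h) (through n A)"
      using fun.inj_map[OF permutes_inj[OF hp]] by (rule inj_on_subset) simp
    ultimately show ?thesis by (meson card_inj_on_le finite_through)
  qed
  show ?thesis using le[of A B] le[of B A] assms by simp
qed

text \<open>Every maximal chain meets the level of \<open>A\<close> in exactly one set, and all sets
  of that level are equally likely. So a random chain contains \<open>A\<close> with probability
  \<open>1 / (n choose card A)\<close>.\<close>

lemma card_through:
  assumes A: "A \<subseteq> {1..n}"
  shows "card (through n A) * (n choose card A) = fact n"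
proof -
  have cA: "card A \<le> n" using card_mono[OF _ A] by simp
  define L where "L = {B. B \<subseteq> {1..n} \<and> card B = card A}"
  have L: "card L = n choose card A" using n_subsets[of "{1..n}" "card A"] by (simp add: L_def)
  have finL: "finite L" by (rule finite_subset[of _ "Pow {1..n}"]) (auto simp: L_def)
  have "{\<pi>. \<pi> permutes {1..n}} = (\<Union>B\<in>L. through n B)"
  proof (intro equalityI subsetI)
    fix \<pi> assume "\<pi> \<in> {\<pi>. \<pi> permutes {1..n}}"
    then have p: "\<pi> permutes {1..n}" by simp
    have "card (\<pi> ` {1..card A}) = card A"
      using permutes_inj[OF p] by (simp add: card_image inj_on_subset)
    moreover have "\<pi> ` {1..card A} \<subseteq> {1..n}"
      using cA permutes_image[OF p] by (metis atLeastatMost_subset_iff image_mono order_refl)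
    ultimately have "\<pi> ` {1..card A} \<in> L" "\<pi> \<in> through n (\<pi> ` {1..card A})"
      using p by (auto simp: L_def through_def)
    then show "\<pi> \<in> (\<Union>B\<in>L. through n B)" by blast
  qed (auto simp: through_def)
  moreover have "card (\<Union>B\<in>L. through n B) = (\<Sum>B\<in>L. card (through n B))"
  proof (intro card_UN_disjoint ballI impI)
    fix B C assume "B \<in> L" "C \<in> L" "B \<noteq> C"
    then show "through n B \<inter> through n C = {}" by (auto simp: L_def through_def)
  qed (use finL in auto)
  moreover have "card (through n B) = card (through n A)" if "B \<in> L" for B
    using that A by (intro card_through_eq) (auto simp: L_def)
  then have "(\<Sum>B\<in>L. card (through n B)) = (\<Sum>B\<in>L. card (through n A))"
    by (rule sum.cong[OF refl])
  ultimately show ?thesis using L card_permutations[of "{1..n}" n] by (simp add: mult.commute)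
qed

lemma card_through_pos:
  assumes "A \<subseteq> {1..n}" shows "card (through n A) > 0"
  using card_through[OF assms] by (metis fact_nonzero gr0I mult_is_0)

text \<open>Transposing two elements of \<open>V\<close> preserves \<open>A\<close>, so all elements
  of \<open>V\<close> are equally likely at position \<open>i\<close>. These events are disjoint, so
  each has conditional probability at most \<open>1 / card V\<close>.\<close>

lemma card_through_at:
  assumes A: "A \<subseteq> {1..n}" and V: "V = A \<or> V = {1..n} - A" and x: "x \<in> V"
  shows "card {\<pi> \<in> through n A. \<pi> i = x} * card V \<le> card (through n A)"
proof -
  have finV: "finite V" using V A by (auto intro: finite_subset)
  have Vn: "V \<subseteq> {1..n}" using V A by auto
  have eq: "card {\<pi> \<in> through n A. \<pi> i = x} \<le> card {\<pi> \<in> through n A. \<pi> i = y}" if y: "y \<in> V" for y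
  proof (rule card_inj_on_le)
    let ?t = "transpose x y"
    have tp: "?t permutes {1..n}" using x y Vn by (intro permutes_swap_id) auto
    have tA: "?t ` A = A"
      using x y V by (intro transpose_image_eq) auto
    then show "(\<circ>) ?t ` {\<pi> \<in> through n A. \<pi> i = x} \<subseteq> {\<pi> \<in> through n A. \<pi> i = y}"
      using through_compose[OF tp tA] by auto
    show "inj_on ((\<circ>) ?t) {\<pi> \<in> through n A. \<pi> i = x}"
      using fun.inj_map[OF permutes_inj[OF tp]] by (rule inj_on_subset) simp
  qed simp
  have "card {\<pi> \<in> through n A. \<pi> i = x} * card V = (\<Sum>y\<in>V. card {\<pi> \<in> through n A. \<pi> i = x})"
    by (simp add: mult.commute)
  also have "\<dots> \<le> (\<Sum>y\<in>V. card {\<pi> \<in> through n A. \<pi> i = y})"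
    by (intro sum_mono eq)
  also have "\<dots> = card (\<Union>y\<in>V. {\<pi> \<in> through n A. \<pi> i = y})"
    using finV by (intro card_UN_disjoint[symmetric]) auto
  also have "\<dots> \<le> card (through n A)"
    by (intro card_mono) auto
  finally show ?thesis .
qed

text \<open>Union bound over the forbidden pairs of a position and a value in
  \<open>Q\<close>.\<close>

lemma card_through_bad:
  assumes A: "A \<subseteq> {1..n}" and V: "V = A \<or> V = {1..n} - A" and Q: "finite Q" "snd ` Q \<subseteq> V"
  shows "card {\<pi> \<in> through n A. \<exists>(i, x)\<in>Q. \<pi> i = x} * card V \<le> card Q * card (through n A)"
proof -
  have "{\<pi> \<in> through n A. \<exists>(i, x)\<in>Q. \<pi> i = x} = (\<Union>q\<in>Q. {\<pi> \<in> through n A. \<pi> (fst q) = snd q})"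
    by auto
  then have "card {\<pi> \<in> through n A. \<exists>(i, x)\<in>Q. \<pi> i = x}
      \<le> (\<Sum>q\<in>Q. card {\<pi> \<in> through n A. \<pi> (fst q) = snd q})"
    using card_UN_le[OF Q(1), of "\<lambda>q. {\<pi> \<in> through n A. \<pi> (fst q) = snd q}"] by simp
  then have "card {\<pi> \<in> through n A. \<exists>(i, x)\<in>Q. \<pi> i = x} * card V
      \<le> (\<Sum>q\<in>Q. card {\<pi> \<in> through n A. \<pi> (fst q) = snd q} * card V)"
    unfolding sum_distrib_right[symmetric] by (rule mult_le_mono1)
  also have "\<dots> \<le> (\<Sum>q\<in>Q. card (through n A))"
    using Q by (intro sum_mono card_through_at[OF A V]) auto
  finally show ?thesis by simp
qed

section \<open>Stable systems of ranked sets\<close>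

definition hits :: "nat \<Rightarrow> nat set \<Rightarrow> nat set set \<Rightarrow> (nat \<Rightarrow> nat) set" where
  "hits n A \<B> = {\<pi> \<in> through n A. \<exists>B\<in>\<B>. \<pi> \<in> through n B}"

definition side :: "(nat set \<times> nat) set \<Rightarrow> nat set \<Rightarrow> nat \<Rightarrow> nat \<Rightarrow> nat set set" where
  "side S A j i = {B. (B, i) \<in> S \<and> (if j < i then A \<subset> B else B \<subset> A)}"

text \<open>The quotient of the two cardinalities is the probability of \<open>hits\<close>,
  conditional on the chain passing through \<open>A\<close>. A pair \<open>(A, j)\<close> records a
  set together with a prospective rank; one set may occur with several ranks.\<close>

definition rich :: "nat \<Rightarrow> nat \<Rightarrow> real \<Rightarrow> (nat set \<times> nat) set \<Rightarrow> nat set \<times> nat \<Rightarrow> bool" where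
  "rich n k \<delta> S = (\<lambda>(A, j). \<forall>i\<in>{1..k} - {j}.
     \<delta> * real (card (through n A)) \<le> real (card (hits n A (side S A j i))))"

text \<open>Discard failing elements one at a time and let \<open>t\<close> record the time of
  removal. Then the elements \<open>y\<close> with \<open>t x \<le> t y\<close> are those still
  present just before \<open>x\<close> goes.\<close>

lemma elimination_order:
  fixes ok :: "'b set \<Rightarrow> 'b \<Rightarrow> bool"
  assumes "finite U" and "\<And>S. S \<subseteq> U \<Longrightarrow> S \<noteq> {} \<Longrightarrow> \<exists>x\<in>S. \<not> ok S x"
  shows "\<exists>t::'b \<Rightarrow> nat. \<forall>x\<in>U. \<not> ok {y \<in> U. t x \<le> t y} x"
  using assms
proof (induction "card U" arbitrary: U)
  case 0
  then show ?case by auto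
next
  case (Suc c)
  then have "U \<noteq> {}" by auto
  with Suc.prems obtain x where x: "x \<in> U" "\<not> ok U x" by blast
  have "\<exists>t::'b \<Rightarrow> nat. \<forall>z\<in>U - {x}. \<not> ok {y \<in> U - {x}. t z \<le> t y} z"
    using Suc.hyps(2) Suc.prems x by (intro Suc.hyps(1)) auto
  then obtain t :: "'b \<Rightarrow> nat" where t: "\<And>z. z \<in> U - {x} \<Longrightarrow> \<not> ok {y \<in> U - {x}. t z \<le> t y} z"
    by blast
  \<comment> \<open>The element discarded first gets time 0, and all later times shift by
    one.\<close>
  define t' where "t' z = (if z = x then 0 else Suc (t z))" for z
  have "{y \<in> U. t' x \<le> t' y} = U" by (auto simp: t'_def)
  moreover have "{y \<in> U. t' z \<le> t' y} = {y \<in> U - {x}. t z \<le> t y}" if "z \<noteq> x" for z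
    using that by (auto simp: t'_def)
  ultimately have "\<not> ok {y \<in> U. t' z \<le> t' y} z" if "z \<in> U" for z
    using t[of z] x that by (cases "z = x") auto
  then show ?case by blast
qed

text \<open>The sum in \<open>large\<close> is the expected number of members of \<open>\<F>\<close>
  on a random chain. If everything could be discarded, that number would be at most
  \<open>k - 1\<close> plus the number of exceptional pairs, whose expectation is at most
  \<open>k * \<delta>\<close> times the same sum. This contradicts \<open>large\<close>.\<close>

lemma ex_rich_system:
  assumes F: "\<F> \<subseteq> Pow {1..n}" and k: "k \<ge> 1"
    and large: "(1 - real k * \<delta>) * (\<Sum>A\<in>\<F>. 1 / real (n choose card A)) > real k - 1"
  shows "\<exists>S. S \<subseteq> \<F> \<times> {1..k} \<and> S \<noteq> {} \<and> (\<forall>x\<in>S. rich n k \<delta> S x)"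
proof (rule ccontr)
  assume neg: "\<not> (\<exists>S. S \<subseteq> \<F> \<times> {1..k} \<and> S \<noteq> {} \<and> (\<forall>x\<in>S. rich n k \<delta> S x))"
  define U where "U = \<F> \<times> {1..k}"
  define N where "N A = card (through n A)" for A
  have finF: "finite \<F>" using F by (rule finite_subset) simp
  have finU: "finite U" using finF by (simp add: U_def)
  have unstable: "\<exists>x\<in>S. \<not> rich n k \<delta> S x" if "S \<subseteq> U" "S \<noteq> {}" for S
    using that neg unfolding U_def by blast
  from elimination_order[OF finU unstable] obtain t :: "nat set \<times> nat \<Rightarrow> nat"
    where t: "\<And>x. x \<in> U \<Longrightarrow> \<not> rich n k \<delta> {y \<in> U. t x \<le> t y} x"
    by blast
  have "\<forall>x\<in>U. \<exists>i\<in>{1..k} - {snd x}.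
      real (card (hits n (fst x) (side {y \<in> U. t x \<le> t y} (fst x) (snd x) i))) < \<delta> * real (N (fst x))"
  proof
    fix x assume "x \<in> U"
    from t[OF this] show "\<exists>i\<in>{1..k} - {snd x}. real (card (hits n (fst x)
        (side {y \<in> U. t x \<le> t y} (fst x) (snd x) i))) < \<delta> * real (N (fst x))"
      unfolding rich_def N_def split_def by (simp only: ball_simps not_le simp_thms)
  qed
  then have "\<exists>w. \<forall>x\<in>U. w x \<in> {1..k} - {snd x} \<and>
      real (card (hits n (fst x) (side {y \<in> U. t x \<le> t y} (fst x) (snd x) (w x)))) < \<delta> * real (N (fst x))"
    by (intro bchoice) (simp only: Bex_def)
  \<comment> \<open>\<open>w x\<close> is the rank that makes \<open>x\<close> fail at the moment of
    its removal.\<close>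
  then obtain w where w: "\<And>x. x \<in> U \<Longrightarrow> w x \<in> {1..k} - {snd x}"
    and w_less: "\<And>x. x \<in> U \<Longrightarrow>
      real (card (hits n (fst x) (side {y \<in> U. t x \<le> t y} (fst x) (snd x) (w x)))) < \<delta> * real (N (fst x))"
    by blast
  \<comment> \<open>The exceptional event of \<open>x\<close>: the chain passes through the set of
    \<open>x\<close> and still meets the failing rank on the correct side. By \<open>w_less\<close>
    its conditional probability is below \<open>\<delta>\<close>.\<close>
  define exc where "exc x = hits n (fst x) (side {y \<in> U. t x \<le> t y} (fst x) (snd x) (w x))" for x
  define M where "M = {\<pi>. \<pi> permutes {1..n}}"
  have finM: "finite M" by (simp add: M_def finite_permutations)
  have excsub: "exc x \<subseteq> M" for x by (auto simp: exc_def hits_def through_def M_def)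
  have key: "card {A \<in> \<F>. \<pi> \<in> through n A} \<le> (k - 1) + card {x \<in> U. \<pi> \<in> exc x}" for \<pi>
  proof -
    \<comment> \<open>\<open>C\<close> holds the members on the chain none of whose ranks is
      exceptional; every other member on the chain is the first component of an exceptional
      pair.\<close>
    define C where "C = {A \<in> \<F>. \<pi> \<in> through n A \<and> (\<forall>j\<in>{1..k}. \<pi> \<notin> exc (A, j))}"
    have "card C \<le> k - 1"
    proof (rule ccontr)
      assume "\<not> card C \<le> k - 1"
      then have kC: "k \<le> card C" by simp
      have finC: "finite C" using finF by (simp add: C_def)
      have inj: "inj_on card C"
        by (rule inj_onI) (auto simp: C_def through_def)
      define L where "L = sorted_list_of_set (card ` C)"
      have L: "sorted L" "distinct L" "set L = card ` C" "length L = card C"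
        using finC inj by (auto simp: L_def card_image)
      \<comment> \<open>The \<open>k\<close> smallest sets of \<open>C\<close> receive the ranks
        \<open>1\<close> to \<open>k\<close> in order of size; the shift by one is there because
        lists are indexed from 0.\<close>
      have "\<forall>j\<in>{1..k}. \<exists>B\<in>C. card B = L ! (j - 1)"
      proof
        fix j assume "j \<in> {1..k}"
        then have "L ! (j - 1) \<in> set L" using kC L(4) by (intro nth_mem) auto
        then show "\<exists>B\<in>C. card B = L ! (j - 1)" using L(3) by force
      qed
      then obtain B where B: "\<And>j. j \<in> {1..k} \<Longrightarrow> B j \<in> C"
        and cB: "\<And>j. j \<in> {1..k} \<Longrightarrow> card (B j) = L ! (j - 1)" by metis
      have mono: "B i \<subset> B j" if "i \<in> {1..k}" "j \<in> {1..k}" "i < j" for i j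
      proof -
        have "L ! (i - 1) < L ! (j - 1)"
          using L kC that by (intro strict_sorted_iff[THEN iffD2, THEN sorted_wrt_nth_less]) auto
        then have "card (B i) < card (B j)" using cB that by simp
        then show ?thesis
          using through_subset[of \<pi> n "B i" "B j"] B that by (auto simp: C_def)
      qed
      \<comment> \<open>Among the pairs \<open>(B j, j)\<close>, the one discarded first still sees all the others.\<close>
      obtain j where j: "j \<in> {1..k}" and jmin: "\<And>i. i \<in> {1..k} \<Longrightarrow> t (B j, j) \<le> t (B i, i)"
        using ex_min_if_finite[of "(\<lambda>j. t (B j, j)) ` {1..k}"] k
        by (force simp: not_less)
      have BU: "(B i, i) \<in> U" if "i \<in> {1..k}" for i
        using B[OF that] that by (auto simp: U_def C_def)
      define i where "i = w (B j, j)"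
      have i: "i \<in> {1..k}" "i \<noteq> j" using w[OF BU[OF j]] by (auto simp: i_def)
      have "B i \<in> side {y \<in> U. t (B j, j) \<le> t y} (B j) j i"
        using BU[OF i(1)] jmin[OF i(1)] mono[of i j] mono[of j i] i j by (auto simp: side_def)
      then have "\<pi> \<in> exc (B j, j)"
        using B[OF i(1)] B[OF j] by (auto simp: exc_def hits_def C_def i_def)
      with B[OF j] j show False by (auto simp: C_def)
    qed
    moreover have "{A \<in> \<F>. \<pi> \<in> through n A} \<subseteq> C \<union> fst ` {x \<in> U. \<pi> \<in> exc x}"
      by (force simp: C_def U_def)
    then have "card {A \<in> \<F>. \<pi> \<in> through n A} \<le> card (C \<union> fst ` {x \<in> U. \<pi> \<in> exc x})"
      using finF finU by (intro card_mono) (auto simp: C_def)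
    moreover have "card (C \<union> fst ` {x \<in> U. \<pi> \<in> exc x}) \<le> card C + card {x \<in> U. \<pi> \<in> exc x}"
      using finU by (intro order_trans[OF card_Un_le] add_left_mono card_image_le) auto
    ultimately show ?thesis by linarith
  qed
  \<comment> \<open>Double counting of incidences between permutations and sets, then
    \<open>key\<close> for each permutation, then double counting of the exceptional events.\<close>
  have "(\<Sum>A\<in>\<F>. N A) = (\<Sum>A\<in>\<F>. \<Sum>\<pi>\<in>M. if \<pi> \<in> through n A then 1 else 0)"
  proof (rule sum.cong)
    fix A
    have "M \<inter> {\<pi>. \<pi> \<in> through n A} = through n A" by (auto simp: M_def through_def)
    then show "N A = (\<Sum>\<pi>\<in>M. if \<pi> \<in> through n A then 1 else 0)"
      using finM by (simp add: sum.If_cases N_def)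
  qed simp
  also have "\<dots> = (\<Sum>\<pi>\<in>M. card {A \<in> \<F>. \<pi> \<in> through n A})"
    using finF by (subst sum.swap) (simp add: sum.If_cases Int_def)
  also have "\<dots> \<le> (\<Sum>\<pi>\<in>M. (k - 1) + card {x \<in> U. \<pi> \<in> exc x})"
    by (intro sum_mono key)
  also have "\<dots> = (k - 1) * fact n + (\<Sum>\<pi>\<in>M. card {x \<in> U. \<pi> \<in> exc x})"
    using card_permutations[of "{1..n}" n] by (simp add: sum.distrib M_def)
  also have "(\<Sum>\<pi>\<in>M. card {x \<in> U. \<pi> \<in> exc x}) = (\<Sum>x\<in>U. \<Sum>\<pi>\<in>M. if \<pi> \<in> exc x then 1 else 0)"
    using finU by (subst sum.swap) (simp add: sum.If_cases Int_def)
  also have "\<dots> = (\<Sum>x\<in>U. card (exc x))"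
  proof (rule sum.cong)
    fix x
    have "M \<inter> {\<pi>. \<pi> \<in> exc x} = exc x" using excsub[of x] by blast
    then show "(\<Sum>\<pi>\<in>M. if \<pi> \<in> exc x then 1 else 0) = card (exc x)"
      using finM by (simp add: sum.If_cases)
  qed simp
  finally have "real (\<Sum>A\<in>\<F>. N A) \<le> real ((k - 1) * fact n + (\<Sum>x\<in>U. card (exc x)))"
    by (simp only: of_nat_le_iff)
  also have "\<dots> = (real k - 1) * fact n + (\<Sum>x\<in>U. real (card (exc x)))"
    using k by (simp add: of_nat_diff)
  also have "(\<Sum>x\<in>U. real (card (exc x))) \<le> (\<Sum>x\<in>U. \<delta> * real (N (fst x)))"
    using w_less by (intro sum_mono) (auto simp: exc_def less_imp_le)
  also have "\<dots> = (\<Sum>A\<in>\<F>. \<Sum>j\<in>{1..k}. \<delta> * real (N A))"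
    by (simp only: U_def sum.cartesian_product split_def)
  also have "\<dots> = real k * \<delta> * (\<Sum>A\<in>\<F>. real (N A))"
    by (simp add: sum_distrib_left mult_ac)
  finally have "(1 - real k * \<delta>) * (\<Sum>A\<in>\<F>. real (N A)) \<le> (real k - 1) * fact n"
    by (simp add: algebra_simps)
  moreover have "real (N A) = fact n * (1 / real (n choose card A))" if "A \<in> \<F>" for A
  proof -
    have A: "A \<subseteq> {1..n}" using F that by auto
    then have "n choose card A > 0" using card_mono[OF _ A] by simp
    moreover have "real (N A) * real (n choose card A) = fact n"
      unfolding N_def using card_through[OF A] by (metis of_nat_fact of_nat_mult)
    ultimately show ?thesis by (simp add: field_simps)
  qed
  then have "(\<Sum>A\<in>\<F>. real (N A)) = fact n * (\<Sum>A\<in>\<F>. 1 / real (n choose card A))"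
    by (simp only: sum_distrib_left cong: sum.cong)
  ultimately have "((1 - real k * \<delta>) * (\<Sum>A\<in>\<F>. 1 / real (n choose card A))) * fact n
      \<le> (real k - 1) * fact n"
    by (simp only: mult_ac)
  then show False using large by (simp add: not_less mult_le_cancel_right)
qed

section \<open>One-step extensions inside a stable system\<close>

text \<open>Among the chains through \<open>A\<close>, the fraction meeting a forbidden pair is at
  most \<open>card Q / card V\<close>, below \<open>\<delta>\<close>, while the fraction that hits
  \<open>\<B>\<close> is at least \<open>\<delta>\<close>. Some chain hits \<open>\<B>\<close> and
  avoids \<open>Q\<close>.\<close>

lemma rich_avoid:
  assumes A: "A \<subseteq> {1..n}" and V: "V = A \<or> V = {1..n} - A" and Q: "finite Q" "snd ` Q \<subseteq> V"
    and small: "real (card Q) < \<delta> * real (card V)"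
    and many: "\<delta> * real (card (through n A)) \<le> real (card (hits n A \<B>))"
  obtains \<pi> B where "\<pi> \<in> through n A" "\<pi> \<in> through n B" "B \<in> \<B>" "\<And>i x. (i, x) \<in> Q \<Longrightarrow> \<pi> i \<noteq> x"
proof -
  let ?bad = "{\<pi> \<in> through n A. \<exists>(i, x)\<in>Q. \<pi> i = x}"
  have "real (card ?bad) * real (card V) \<le> real (card Q) * real (card (through n A))"
    using card_through_bad[OF A V Q] by (simp only: of_nat_mult[symmetric] of_nat_le_iff)
  also have "\<dots> < (\<delta> * real (card V)) * real (card (through n A))"
    using small card_through_pos[OF A] by (intro mult_strict_right_mono) auto
  also have "\<dots> = (\<delta> * real (card (through n A))) * real (card V)"
    by (simp add: mult_ac)
  also have "\<dots> \<le> real (card (hits n A \<B>)) * real (card V)"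
    using many by (intro mult_right_mono) auto
  finally have "card ?bad < card (hits n A \<B>)"
    by (simp add: mult_less_cancel_right)
  then have "\<not> hits n A \<B> \<subseteq> ?bad"
    using card_mono[of ?bad "hits n A \<B>"] by auto
  then obtain \<pi> where "\<pi> \<in> hits n A \<B>" "\<pi> \<notin> ?bad" by blast
  then obtain B where "\<pi> \<in> through n A" "B \<in> \<B>" "\<pi> \<in> through n B" "\<not> (\<exists>(i, x)\<in>Q. \<pi> i = x)"
    by (auto simp: hits_def)
  then show thesis by (intro that[of \<pi> B]) auto
qed

text \<open>The two requirements differ in price. To keep an element of \<open>Z\<close> out of
  \<open>B\<close> it must be barred from all \<open>s\<close> positions after \<open>A\<close>. To
  leave \<open>A \<union> Y\<close> it is enough that the first element added to \<open>A\<close> is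
  not in \<open>Y\<close>, so a set \<open>Y - A\<close> of size of order \<open>s\<close> is
  affordable.\<close>

lemma rich_extend_up:
  assumes rich: "rich n k \<delta> S (A, j)" and A: "A \<subseteq> {1..n}" and i: "j < i" "i \<le> k"
    and close: "\<And>B. (B, i) \<in> S \<Longrightarrow> B \<subseteq> {1..n} \<and> card B \<le> card A + s"
    and Z: "finite Z" "Z \<inter> A = {}" and Y: "finite Y"
    and small: "real (card Z * s + card (Y - A)) < \<delta> * real (n - card A)"
  obtains B where "(B, i) \<in> S" "A \<subset> B" "B \<inter> Z = {}" "\<not> B \<subseteq> A \<union> Y"
proof -
  let ?V = "{1..n} - A" and ?a = "card A"
  \<comment> \<open>Positions \<open>?a + 1\<close> to \<open>?a + s\<close> cover everything that
    can be added between \<open>A\<close> and \<open>B\<close>; position \<open>?a + 1\<close> is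
    certainly added.\<close>
  define Q where "Q = {?a<..?a + s} \<times> (Z \<inter> ?V) \<union> {?a + 1} \<times> (Y \<inter> ?V)"
  have finA: "finite A" using A by (auto intro: finite_subset)
  have cV: "card ?V = n - ?a" using A finA by (simp add: card_Diff_subset)
  have "card Q \<le> card ({?a<..?a + s} \<times> (Z \<inter> ?V)) + card ({?a + 1} \<times> (Y \<inter> ?V))"
    unfolding Q_def by (rule card_Un_le)
  also have "\<dots> = s * card (Z \<inter> ?V) + card (Y \<inter> ?V)"
    by (simp only: card_cartesian_product) simp
  also have "\<dots> \<le> s * card Z + card (Y - A)"
    using Z Y by (intro add_mono mult_le_mono2 card_mono) auto
  finally have "real (card Q) \<le> real (card Z * s + card (Y - A))"
    by (simp only: of_nat_le_iff mult.commute)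
  with small have less: "real (card Q) < \<delta> * real (card ?V)"
    unfolding cV by (rule le_less_trans[rotated])
  have many: "\<delta> * real (card (through n A)) \<le> real (card (hits n A (side S A j i)))"
    using rich i by (auto simp: rich_def)
  have Q: "finite Q" "snd ` Q \<subseteq> ?V" using Z Y by (auto simp: Q_def)
  obtain \<pi> B where \<pi>: "\<pi> \<in> through n A" "\<pi> \<in> through n B" and B: "B \<in> side S A j i"
    and avoid: "\<And>i x. (i, x) \<in> Q \<Longrightarrow> \<pi> i \<noteq> x"
    using rich_avoid[OF A disjI2[OF refl] Q less many] by blast
  have perm: "\<pi> permutes {1..n}" and \<pi>A: "\<pi> ` {1..?a} = A" and \<pi>B: "\<pi> ` {1..card B} = B"
    using \<pi> by (auto simp: through_def)
  have BS: "(B, i) \<in> S" "A \<subset> B" using B i by (auto simp: side_def)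
  have ab: "?a < card B"
    using through_subset[OF \<pi>(2,1)] BS(2) by (meson leI psubsetE)
  have inA: "\<pi> x \<in> A \<longleftrightarrow> x \<in> {1..?a}" for x
    using \<pi>A inj_image_mem_iff[OF permutes_inj[OF perm], of x "{1..?a}"] by simp
  have inB: "\<pi> x \<in> B \<longleftrightarrow> x \<in> {1..card B}" for x
    using \<pi>B inj_image_mem_iff[OF permutes_inj[OF perm], of x "{1..card B}"] by simp
  have Bn: "B \<subseteq> {1..n}" using close[OF BS(1)] by blast
  show thesis
  proof
    show "(B, i) \<in> S" "A \<subset> B" by fact+
    show "B \<inter> Z = {}"
    proof (rule ccontr)
      assume "B \<inter> Z \<noteq> {}"
      then obtain z where z: "z \<in> B" "z \<in> Z" by blast
      then obtain x where x: "z = \<pi> x" "x \<in> {1..card B}" using \<pi>B by blast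
      have "z \<notin> A" using z Z by blast
      then have "x \<in> {?a<..?a + s}" "z \<in> ?V"
        using x inA[of x] close[OF BS(1)] z Bn by auto
      then show False using avoid[of x z] z x by (auto simp: Q_def)
    qed
    show "\<not> B \<subseteq> A \<union> Y"
    proof
      assume "B \<subseteq> A \<union> Y"
      moreover have "\<pi> (?a + 1) \<in> B" "\<pi> (?a + 1) \<notin> A" using inA inB ab by auto
      ultimately have "(?a + 1, \<pi> (?a + 1)) \<in> Q" using Bn by (auto simp: Q_def)
      then show False using avoid by blast
    qed
  qed
qed

text \<open>The dual of the upward step: the elements of \<open>A - B\<close> occupy the last
  positions up to \<open>card A\<close>. Barring \<open>Z\<close> from the last \<open>s\<close> of
  them keeps \<open>Z\<close> inside \<open>B\<close>, and the element at position
  \<open>card A\<close>, which is always lost, is kept outside \<open>Y\<close>.\<close>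

lemma rich_extend_down:
  assumes rich: "rich n k \<delta> S (A, j)" and A: "A \<subseteq> {1..n}" and i: "i < j" "1 \<le> i" "j \<le> k"
    and close: "\<And>B. (B, i) \<in> S \<Longrightarrow> card A \<le> card B + s"
    and Z: "Z \<subseteq> A"
    and small: "real (card Z * s + card (A \<inter> Y)) < \<delta> * real (card A)"
  obtains B where "(B, i) \<in> S" "B \<subset> A" "Z \<subseteq> B" "\<not> A \<subseteq> B \<union> Y"
proof -
  let ?a = "card A"
  \<comment> \<open>If \<open>s\<close> exceeds \<open>?a\<close>, the truncated difference is 0 and
    the interval consists of all positions of \<open>A\<close>.\<close>
  define Q where "Q = {?a - s<..?a} \<times> Z \<union> {?a} \<times> (A \<inter> Y)"
  have finA: "finite A" using A by (auto intro: finite_subset)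
  have finZ: "finite Z" using Z finA by (rule finite_subset)
  have "card Q \<le> card ({?a - s<..?a} \<times> Z) + card ({?a} \<times> (A \<inter> Y))"
    unfolding Q_def by (rule card_Un_le)
  also have "\<dots> \<le> s * card Z + card (A \<inter> Y)"
    by (simp only: card_cartesian_product) (simp, arith)
  finally have "real (card Q) \<le> real (card Z * s + card (A \<inter> Y))"
    by (simp only: of_nat_le_iff mult.commute)
  with small have less: "real (card Q) < \<delta> * real (card A)" by simp
  have many: "\<delta> * real (card (through n A)) \<le> real (card (hits n A (side S A j i)))"
    using rich i by (auto simp: rich_def)
  have Q: "finite Q" "snd ` Q \<subseteq> A" using Z finZ finA by (auto simp: Q_def)
  obtain \<pi> B where \<pi>: "\<pi> \<in> through n A" "\<pi> \<in> through n B" and B: "B \<in> side S A j i"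
    and avoid: "\<And>i x. (i, x) \<in> Q \<Longrightarrow> \<pi> i \<noteq> x"
    using rich_avoid[OF A disjI1[OF refl] Q less many] by blast
  have perm: "\<pi> permutes {1..n}" and \<pi>A: "\<pi> ` {1..?a} = A" and \<pi>B: "\<pi> ` {1..card B} = B"
    using \<pi> by (auto simp: through_def)
  have BS: "(B, i) \<in> S" "B \<subset> A" using B i by (auto simp: side_def)
  have ba: "card B < ?a" using psubset_card_mono[OF finA BS(2)] .
  have inB: "\<pi> x \<in> B \<longleftrightarrow> x \<in> {1..card B}" for x
    using \<pi>B inj_image_mem_iff[OF permutes_inj[OF perm], of x "{1..card B}"] by simp
  show thesis
  proof
    show "(B, i) \<in> S" "B \<subset> A" by fact+
    show "Z \<subseteq> B"
    proof
      fix z assume z: "z \<in> Z"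
      then obtain x where x: "z = \<pi> x" "x \<in> {1..?a}" using \<pi>A Z by blast
      show "z \<in> B"
      proof (rule ccontr)
        assume "z \<notin> B"
        then have "x \<in> {?a - s<..?a}" using x inB[of x] close[OF BS(1)] by auto
        then show False using avoid[of x z] z x by (auto simp: Q_def)
      qed
    qed
    show "\<not> A \<subseteq> B \<union> Y"
    proof
      assume "A \<subseteq> B \<union> Y"
      moreover have "\<pi> ?a \<in> A" "\<pi> ?a \<notin> B" using \<pi>A inB ba by auto
      ultimately have "(?a, \<pi> ?a) \<in> Q" by (auto simp: Q_def)
      then show False using avoid by blast
    qed
  qed
qed

section \<open>Embedding tree posets\<close>

text \<open>\<open>K\<close> bounds the number of sets to be avoided, and \<open>2 * K * s\<close> the distance between any two
  sets of a partial embedding.\<close>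

locale extendable =
  fixes R :: "nat \<Rightarrow> nat set set" and k s K :: nat
  assumes finite_R: "A \<in> R i \<Longrightarrow> finite A"
    and close: "A \<in> R i \<Longrightarrow> B \<in> R j \<Longrightarrow> card A \<le> card B + s"
    and up: "A \<in> R j \<Longrightarrow> j < i \<Longrightarrow> i \<le> k \<Longrightarrow> finite Z \<Longrightarrow> Z \<inter> A = {} \<Longrightarrow> card Z \<le> K \<Longrightarrow>
      finite Y \<Longrightarrow> card (Y - A) \<le> 2 * K * K * s \<Longrightarrow>
      \<exists>B\<in>R i. A \<subset> B \<and> B \<inter> Z = {} \<and> \<not> B \<subseteq> A \<union> Y"
    and down: "A \<in> R j \<Longrightarrow> 1 \<le> i \<Longrightarrow> i < j \<Longrightarrow> j \<le> k \<Longrightarrow> Z \<subseteq> A \<Longrightarrow> card Z \<le> K \<Longrightarrow>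
      card (A \<inter> Y) \<le> 2 * K * K * s \<Longrightarrow>
      \<exists>B\<in>R i. B \<subset> A \<and> Z \<subseteq> B \<and> \<not> A \<subseteq> B \<union> Y"
begin

text \<open>\<open>d\<close> counts steps between comparable members of \<open>R\<close>, each of
  which changes at most \<open>s\<close> elements.\<close>

definition near :: "nat \<Rightarrow> nat set \<Rightarrow> nat set \<Rightarrow> bool" where
  "near d A B \<longleftrightarrow> card (A - B) \<le> d * s \<and> card (B - A) \<le> d * s"

lemma near_mono: "near d A B \<Longrightarrow> d \<le> e \<Longrightarrow> near e A B"
  unfolding near_def by (meson mult_le_mono1 order_trans)

text \<open>Comparable sets differ by exactly the difference of their sizes, which
  \<open>close\<close> bounds by \<open>s\<close>; the rest is the triangle inequality for set
  differences.\<close>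

lemma near_step:
  assumes A: "A \<in> R i" and B: "B \<in> R j" and C: "finite C" and near: "near d A C"
    and AB: "A \<subset> B \<or> B \<subset> A"
  shows "near (Suc d) B C"
proof -
  have fin: "finite A" "finite B" using A B finite_R by auto
  have "card (A - B) \<le> s \<and> card (B - A) \<le> s"
  proof (cases "A \<subset> B")
    case True
    then have "card (B - A) \<le> s"
      using close[OF B A] fin by (simp add: card_Diff_subset psubset_imp_subset)
    moreover have "card (A - B) = 0" using True by (metis Diff_eq_empty_iff card.empty psubset_imp_subset)
    ultimately show ?thesis by simp
  next
    case False
    with AB have BA: "B \<subset> A" by blast
    then have "card (A - B) \<le> s"
      using close[OF A B] fin by (simp add: card_Diff_subset psubset_imp_subset)
    moreover have "card (B - A) = 0" using BA by (metis Diff_eq_empty_iff card.empty psubset_imp_subset)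
    ultimately show ?thesis by simp
  qed
  moreover have "card (B - C) \<le> card ((B - A) \<union> (A - C))"
    using fin by (intro card_mono) auto
  moreover have "card (C - B) \<le> card ((C - A) \<union> (A - B))"
    using fin C by (intro card_mono) auto
  ultimately show ?thesis
    using near card_Un_le[of "B - A" "A - C"] card_Un_le[of "C - A" "A - B"]
    unfolding near_def mult_Suc by linarith
qed

lemma card_Diff_near:
  assumes "near d A C" "near d B C" "finite A" "finite C"
  shows "card (A - B) \<le> 2 * d * s"
proof -
  have "card (A - B) \<le> card ((A - C) \<union> (C - B))"
    using assms by (intro card_mono) auto
  also have "\<dots> \<le> card (A - C) + card (C - B)" by (rule card_Un_le)
  also have "\<dots> \<le> d * s + d * s" using assms by (intro add_mono) (auto simp: near_def)
  finally show ?thesis by simp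
qed

text \<open>This embeds the lower covers of \<open>m\<close>. The sets are chosen one by one: each
  chosen set has an element outside \<open>A0\<close> that the new set avoids, and the new set gets
  an element outside \<open>A0\<close> and all the chosen sets. So no inclusion arises in either
  direction.\<close>

lemma ex_antichain:
  assumes k: "2 \<le> k" and A0: "A0 \<in> R 1" and N: "finite N" "card N < K" and \<rho>: "\<rho> ` N \<subseteq> {1..k}"
  shows "\<exists>G. \<forall>c\<in>N. G c \<in> R (\<rho> c) \<and> near 2 (G c) A0 \<and> \<not> G c \<subseteq> A0 \<and>
    (\<forall>d\<in>N. G c \<subseteq> G d \<longrightarrow> c = d)"
  using N \<rho>
proof (induction N)
  case empty
  then show ?case by simp
next
  case (insert c N)
  have finA0: "finite A0" using A0 by (rule finite_R)
  have cN: "Suc (card N) < K" using insert by simp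
  obtain G where G: "\<And>d. d \<in> N \<Longrightarrow> G d \<in> R (\<rho> d)" "\<And>d. d \<in> N \<Longrightarrow> near 2 (G d) A0"
    "\<And>d. d \<in> N \<Longrightarrow> \<not> G d \<subseteq> A0" "\<And>d e. d \<in> N \<Longrightarrow> e \<in> N \<Longrightarrow> G d \<subseteq> G e \<Longrightarrow> d = e"
    using insert.IH insert.prems cN by auto
  have "\<forall>d\<in>N. \<exists>x. x \<in> G d - A0" using G(3) by blast
  then obtain x where x: "\<And>d. d \<in> N \<Longrightarrow> x d \<in> G d - A0" by (meson bchoice)
  define Z where "Z = x ` N"
  define Y where "Y = (\<Union>d\<in>N. G d)"
  have Z: "finite Z" "Z \<inter> A0 = {}" "card Z \<le> K"
    using x insert(1) cN card_image_le[of N x] by (auto simp: Z_def)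
  have finY: "finite Y" using insert(1) G(1) finite_R by (auto simp: Y_def)
  have "Y - A0 = (\<Union>d\<in>N. G d - A0)" by (auto simp: Y_def)
  then have "card (Y - A0) \<le> (\<Sum>d\<in>N. card (G d - A0))"
    using card_UN_le[OF insert(1), of "\<lambda>d. G d - A0"] by (simp only:)
  also have "\<dots> \<le> (\<Sum>d\<in>N. 2 * s)" using G(2) by (intro sum_mono) (auto simp: near_def)
  also have "\<dots> \<le> K * (2 * K * s)" using cN by (simp add: mult_le_mono)
  finally have cY: "card (Y - A0) \<le> 2 * K * K * s" by (simp add: mult_ac)
  have near0: "near 0 A0 A0" by (simp add: near_def)
  have "\<exists>B. B \<in> R (\<rho> c) \<and> near 2 B A0 \<and> B \<inter> Z = {} \<and> \<not> B \<subseteq> A0 \<union> Y"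
  proof (cases "\<rho> c = 1")
    case False
    then have "1 < \<rho> c" "\<rho> c \<le> k" using insert.prems by auto
    from up[OF A0 this Z finY cY] obtain B where
      B: "B \<in> R (\<rho> c)" "A0 \<subset> B" "B \<inter> Z = {}" "\<not> B \<subseteq> A0 \<union> Y" by blast
    then have "near 2 B A0"
      using near_mono[OF near_step[OF A0 B(1) finA0 near0]] by auto
    with B show ?thesis by blast
  next
    case True
    \<comment> \<open>Stay in rank 1 but leave \<open>A0\<close> by going up to rank 2 and down again.\<close>
    have "(1::nat) < 2" by simp
    from up[OF A0 this k Z finY cY] obtain A1 where
      A1: "A1 \<in> R 2" "A0 \<subset> A1" "A1 \<inter> Z = {}" "\<not> A1 \<subseteq> A0 \<union> Y" by blast
    \<comment> \<open>Keeping \<open>w\<close> on the way down makes \<open>B\<close> leave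
      \<open>A0 \<union> Y\<close>, while avoidance of \<open>Z\<close> is inherited from
      \<open>A1\<close>.\<close>
    then obtain w where w: "w \<in> A1" "w \<notin> A0 \<union> Y" by blast
    have "\<exists>B\<in>R 1. B \<subset> A1 \<and> {w} \<subseteq> B \<and> \<not> A1 \<subseteq> B \<union> {}"
      using w A1 k cN by (intro down[of A1 2]) auto
    then obtain B where B: "B \<in> R 1" "B \<subset> A1" "w \<in> B" by blast
    have "near (Suc (Suc 0)) B A0"
      using near_step[OF A1(1) B(1) finA0 near_step[OF A0 A1(1) finA0 near0]] A1 B by blast
    then have "near 2 B A0" by (simp add: numeral_2_eq_2)
    moreover have "B \<inter> Z = {}" "\<not> B \<subseteq> A0 \<union> Y" using A1(3) B w by blast+
    ultimately show ?thesis using B(1) True by metis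
  qed
  then obtain B where B: "B \<in> R (\<rho> c)" "near 2 B A0" "B \<inter> Z = {}" "\<not> B \<subseteq> A0 \<union> Y" by blast
  have nsub: "\<not> G d \<subseteq> B" "\<not> B \<subseteq> G d" if "d \<in> N" for d
    using B(3,4) x[OF that] that by (auto simp: Z_def Y_def)
  have "\<not> B \<subseteq> A0" using B(4) by blast
  then have "\<forall>e\<in>insert c N. (G(c := B)) e \<in> R (\<rho> e) \<and> near 2 ((G(c := B)) e) A0 \<and>
      \<not> (G(c := B)) e \<subseteq> A0 \<and>
      (\<forall>d\<in>insert c N. (G(c := B)) e \<subseteq> (G(c := B)) d \<longrightarrow> e = d)"
    using G B(1,2) nsub insert(2) by simp
  then show ?case by (rule exI[of _ "G(c := B)"])
qed

text \<open>Induction on the size of \<open>T\<close>: the star of \<open>m\<close> is the case of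
  \<open>ex_antichain\<close>, and otherwise a leaf off the star is removed and its set added last.
  Nearness to \<open>A0\<close> is carried along because it bounds the sets \<open>Y\<close> in
  \<open>up\<close> and \<open>down\<close>; the radius grows by one with each new set.\<close>

lemma ex_embedding:
  assumes k: "2 \<le> k" and A0: "A0 \<in> R 1"
    and "tree_poset T r" "maximal_in T r m" "card T < K"
    and "\<And>p. p \<in> T - {m} \<Longrightarrow> \<rho> p \<in> {1..k}"
    and "\<And>p q. p \<in> T - {m} \<Longrightarrow> q \<in> T - {m} \<Longrightarrow> (p, q) \<in> r \<Longrightarrow> p \<noteq> q \<Longrightarrow> \<rho> p < \<rho> q"
  shows "\<exists>G. (\<forall>p\<in>T - {m}. G p \<in> R (\<rho> p) \<and> near (Suc (card T)) (G p) A0) \<and>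
    (\<forall>p\<in>T - {m}. \<forall>q\<in>T - {m}. (p, q) \<in> r \<longleftrightarrow> G p \<subseteq> G q) \<and>
    (\<forall>p\<in>T - down_set T r m. \<not> G p \<subseteq> (\<Union>d\<in>down_set T r m - {m}. G d))"
  using assms(3-)
proof (induction "card T" arbitrary: T r rule: less_induct)
  case less
  have finA0: "finite A0" using A0 by (rule finite_R)
  have fin: "finite T" and po: "partial_order_on T r" and tree: "is_tree T (hasse r)"
    using less.prems by (auto simp: tree_poset_def)
  note po' = partial_order_onD[OF po]
  have m: "m \<in> T" and m_max: "\<And>q. (m, q) \<in> r \<Longrightarrow> q = m"
    using less.prems(2) po'(4) by (auto simp: maximal_in_def)
  show ?case
  proof (cases "T = insert m (hasse r `` {m})")
    case True
    \<comment> \<open>By maximality of \<open>m\<close> all its Hasse neighbours are lower covers.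
      So \<open>T - {m}\<close> is an antichain below \<open>m\<close>, and the union condition is
      vacuous.\<close>
    have cov: "(c, m) \<in> covers r" if "c \<in> T - {m}" for c
      using True that m_max by (auto simp: hasse_def covers_def)
    have "\<rho> ` (T - {m}) \<subseteq> {1..k}" using less.prems(4) by (rule image_subsetI)
    then have "\<exists>G. \<forall>c\<in>T - {m}. G c \<in> R (\<rho> c) \<and> near 2 (G c) A0 \<and> \<not> G c \<subseteq> A0 \<and>
        (\<forall>d\<in>T - {m}. G c \<subseteq> G d \<longrightarrow> c = d)"
      using fin less.prems(3) card_Diff1_le[of T m] by (intro ex_antichain k A0) auto
    then obtain G where G: "\<And>c. c \<in> T - {m} \<Longrightarrow> G c \<in> R (\<rho> c)" "\<And>c. c \<in> T - {m} \<Longrightarrow> near 2 (G c) A0"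
      "\<And>c d. c \<in> T - {m} \<Longrightarrow> d \<in> T - {m} \<Longrightarrow> G c \<subseteq> G d \<Longrightarrow> c = d"
      by blast
    have "card T > 0" using fin m by (auto simp: card_gt_0_iff)
    then have "near (Suc (card T)) (G c) A0" if "c \<in> T - {m}" for c
      using near_mono[OF G(2)[OF that]] by simp
    moreover have "(p, q) \<in> r \<longleftrightarrow> G p \<subseteq> G q" if pq: "p \<in> T - {m}" "q \<in> T - {m}" for p q
    proof
      assume "(p, q) \<in> r"
      then have "p = q" using cov[OF pq(1)] cov[OF pq(2)] pq by (auto simp: covers_def)
      then show "G p \<subseteq> G q" by simp
    next
      assume "G p \<subseteq> G q"
      then show "(p, q) \<in> r" using G(3)[OF pq] pq po'(1) by (auto simp: refl_on_def)
    qed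
    moreover have "T - down_set T r m = {}"
      using cov m po'(1) by (auto simp: down_set_def covers_def refl_on_def)
    ultimately show ?thesis using G(1) by blast
  next
    case False
    obtain l a where l: "l \<in> T" "l \<noteq> m" and a: "a \<in> T" "a \<noteq> m" "a \<noteq> l" and leaf: "hasse r `` {l} = {a}"
      by (rule is_tree_leaf_off_star[OF fin hasse_subset[OF po'(4)] sym_hasse irrefl_hasse tree m False])
    define T' where "T' = T - {l}"
    define r' where "r' = Restr r T'"
    have cT: "card T = Suc (card T')" unfolding T'_def using card.remove[OF fin l(1)] .
    have finT': "finite T'" using fin by (simp add: T'_def)
    have T'T: "T' \<subseteq> T" "m \<in> T'" "a \<in> T'" using m l a by (auto simp: T'_def)
    have "\<exists>G. (\<forall>p\<in>T' - {m}. G p \<in> R (\<rho> p) \<and> near (Suc (card T')) (G p) A0) \<and>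
      (\<forall>p\<in>T' - {m}. \<forall>q\<in>T' - {m}. (p, q) \<in> r' \<longleftrightarrow> G p \<subseteq> G q) \<and>
      (\<forall>p\<in>T' - down_set T' r' m. \<not> G p \<subseteq> (\<Union>d\<in>down_set T' r' m - {m}. G d))"
      (is "\<exists>G. ?P G")
    proof (rule less.hyps)
      show "card T' < card T" using cT by simp
      then show "card T' < K" using less.prems(3) by simp
      show "tree_poset T' r'"
        unfolding r'_def T'_def using tree_poset_remove_leaf[OF less.prems(1) leaf] a by blast
      show "maximal_in T' r' m" using T'T m_max by (auto simp: maximal_in_def r'_def)
      show "\<rho> p \<in> {1..k}" if "p \<in> T' - {m}" for p
        using that T'T(1) by (intro less.prems(4)) blast
      show "\<rho> p < \<rho> q" if "p \<in> T' - {m}" "q \<in> T' - {m}" "(p, q) \<in> r'" "p \<noteq> q" for p q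
        using that T'T(1) by (intro less.prems(5)) (auto simp: r'_def)
    qed
    then obtain G where "?P G" ..
    then have G: "\<And>p. p \<in> T' - {m} \<Longrightarrow> G p \<in> R (\<rho> p)"
      and Gnear: "\<And>p. p \<in> T' - {m} \<Longrightarrow> near (Suc (card T')) (G p) A0"
      and Gord': "\<And>p q. p \<in> T' - {m} \<Longrightarrow> q \<in> T' - {m} \<Longrightarrow> (p, q) \<in> r' \<longleftrightarrow> G p \<subseteq> G q"
      and Gdown: "\<And>p. p \<in> T' - down_set T' r' m \<Longrightarrow> \<not> G p \<subseteq> (\<Union>d\<in>down_set T' r' m - {m}. G d)"
      by simp_all
    have Gord: "(p, q) \<in> r \<longleftrightarrow> G p \<subseteq> G q" if "p \<in> T' - {m}" "q \<in> T' - {m}" for p q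
      using Gord'[OF that] that by (auto simp: r'_def)
    define D where "D = down_set T' r' m"
    define W where "W = (\<Union>d\<in>D - {m}. G d)"
    have D: "D = {q \<in> T'. (q, m) \<in> r}" using T'T by (auto simp: D_def down_set_def r'_def)
    have aT: "a \<in> T' - {m}" using T'T a by auto
    have finG: "finite (G q)" if "q \<in> T' - {m}" for q using finite_R[OF G[OF that]] .
    have cK: "card T' + 1 < K" using less.prems(3) cT by simp
    \<comment> \<open>Fewer than \<open>K\<close> sets, each of size at most
      \<open>2 * K * s\<close>: this is the origin of the bound \<open>2 * K * K * s\<close> in the
      locale.\<close>
    have cUn: "card (\<Union>q\<in>T' - {m}. X q) \<le> 2 * K * K * s"
      if "\<And>q. q \<in> T' - {m} \<Longrightarrow> card (X q) \<le> 2 * Suc (card T') * s" for X :: "'a \<Rightarrow> nat set"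
    proof -
      have "card (\<Union>q\<in>T' - {m}. X q) \<le> (\<Sum>q\<in>T' - {m}. card (X q))"
        using finT' by (intro card_UN_le) auto
      also have "\<dots> \<le> (\<Sum>q\<in>T' - {m}. 2 * Suc (card T') * s)" using that by (intro sum_mono)
      also have "\<dots> = card (T' - {m}) * (2 * Suc (card T') * s)" by simp
      also have "\<dots> \<le> K * (2 * K * s)"
        using cK card_Diff1_le[of T' m] by (intro mult_le_mono) auto
      finally show ?thesis by (simp add: mult_ac)
    qed
    have dist: "card (G p - G q) \<le> 2 * Suc (card T') * s" if "p \<in> T' - {m}" "q \<in> T' - {m}" for p q
      using card_Diff_near Gnear that finG finA0 by blast
    \<comment> \<open>What both cases need from the new set \<open>B\<close>: the right
      comparabilities with the sets already placed, and the right position relative to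
      \<open>W\<close>. If \<open>l\<close> is below \<open>m\<close>, then
      \<open>B \<subseteq> W\<close> leaves the union unchanged, so the earlier conditions persist;
      otherwise \<open>B\<close> itself must leave \<open>W\<close>.\<close>
    have finish: ?thesis
      if B: "B \<in> R (\<rho> l)" "B \<subset> G a \<or> G a \<subset> B"
        and ord1: "\<And>q. q \<in> T' - {m} \<Longrightarrow> (q, l) \<in> r \<longleftrightarrow> G q \<subseteq> B"
        and ord2: "\<And>q. q \<in> T' - {m} \<Longrightarrow> (l, q) \<in> r \<longleftrightarrow> B \<subseteq> G q"
        and lD: "(l, m) \<in> r \<Longrightarrow> B \<subseteq> W" "(l, m) \<notin> r \<Longrightarrow> \<not> B \<subseteq> W"
      for B
    proof -
      define G' where "G' = G(l := B)"
      have G'l: "G' l = B" and G'q: "\<And>q. q \<in> T' \<Longrightarrow> G' q = G q" by (auto simp: G'_def T'_def)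
      have split: "p = l \<or> p \<in> T' - {m}" if "p \<in> T - {m}" for p using that by (auto simp: T'_def)
      have "near (Suc (card T)) B A0"
        unfolding cT by (rule near_step[OF G[OF aT] B(1) finA0 Gnear[OF aT]]) (use B in blast)
      moreover have "near (Suc (card T)) (G q) A0" if "q \<in> T' - {m}" for q
        using near_mono[OF Gnear[OF that]] cT by simp
      ultimately have 1: "G' p \<in> R (\<rho> p) \<and> near (Suc (card T)) (G' p) A0" if "p \<in> T - {m}" for p
        using split[OF that] G B(1) G'l G'q by auto
      have ll: "(l, l) \<in> r" using l po'(1) by (auto simp: refl_on_def)
      have 2: "(p, q) \<in> r \<longleftrightarrow> G' p \<subseteq> G' q" if "p \<in> T - {m}" "q \<in> T - {m}" for p q
        using split[OF that(1)] split[OF that(2)] ord1[of p] ord2[of q] Gord[of p q] ll G'l G'q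
        by (elim disjE) simp_all
      have dT: "down_set T r m - {m} = (D - {m}) \<union> (if (l, m) \<in> r then {l} else {})"
        using l by (auto simp: down_set_def D T'_def)
      have "(\<Union>d\<in>D - {m}. G' d) = W" unfolding W_def using G'q by (intro SUP_cong) (auto simp: D)
      then have W': "(\<Union>d\<in>down_set T r m - {m}. G' d) = W"
        unfolding dT using lD(1) G'l by auto
      have 3: "\<not> G' p \<subseteq> W" if p: "p \<in> T - down_set T r m" for p
      proof (cases "p = l")
        case True
        with p l have "(l, m) \<notin> r" by (auto simp: down_set_def)
        with True G'l lD(2) show ?thesis by simp
      next
        case False
        then have "p \<in> T' - D" using p by (auto simp: down_set_def D T'_def)
        then show ?thesis using Gdown[of p] G'q[of p] by (simp add: W_def D_def)
      qed
      show ?thesis using 1 2 3 W' by (intro exI[of _ G']) auto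
    qed
    have lTm: "l \<in> T - {m}" using l by simp
    have aTm: "a \<in> T - {m}" using a by simp
    have "(a, l) \<in> covers r \<or> (l, a) \<in> covers r" using leaf by (auto simp: hasse_def)
    then show ?thesis
    proof
      assume cov: "(a, l) \<in> covers r"
      note ord = leaf_above_neighbour[OF fin po leaf cov]
      have lk: "\<rho> a < \<rho> l" "\<rho> l \<le> k"
        using less.prems(4)[OF lTm] less.prems(5)[OF aTm lTm] cov by (auto simp: covers_def)
      \<comment> \<open>Each \<open>q\<close> not below \<open>a\<close> has a witness
        \<open>x q\<close> in \<open>G q - G a\<close>; avoiding it prevents
        \<open>G q \<subseteq> B\<close>.\<close>
      define N where "N = {q \<in> T' - {m}. (q, a) \<notin> r}"
      have "\<forall>q\<in>N. \<exists>x. x \<in> G q - G a" using Gord aT by (auto simp: N_def)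
      then obtain x where x: "\<And>q. q \<in> N \<Longrightarrow> x q \<in> G q - G a" by (meson bchoice)
      have finN: "finite N" using finT' by (simp add: N_def)
      \<comment> \<open>An element of \<open>B\<close> outside \<open>Y\<close> rules out inclusion
        of \<open>B\<close> in any placed set and in \<open>W\<close>.\<close>
      define Y where "Y = (\<Union>q\<in>T' - {m}. G q)"
      have "card (x ` N) \<le> card N" using finN by (rule card_image_le)
      also have "\<dots> \<le> card T'" using finT' by (intro card_mono) (auto simp: N_def)
      finally have Z: "finite (x ` N)" "x ` N \<inter> G a = {}" "card (x ` N) \<le> K"
        using x finN cK by auto
      have finY: "finite Y" using finT' finG by (auto simp: Y_def)
      have "Y - G a = (\<Union>q\<in>T' - {m}. G q - G a)" by (auto simp: Y_def)
      then have cY: "card (Y - G a) \<le> 2 * K * K * s" 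
        using cUn[of "\<lambda>q. G q - G a"] dist[OF _ aT] by (simp only:)
      from up[OF G[OF aT] lk Z finY cY] obtain B where
        B: "B \<in> R (\<rho> l)" "G a \<subset> B" "B \<inter> x ` N = {}" "\<not> B \<subseteq> G a \<union> Y" by blast
      show ?thesis
      proof (rule finish[OF B(1)])
        fix q assume q: "q \<in> T' - {m}"
        then have ql: "q \<noteq> l" by (auto simp: T'_def)
        show "(q, l) \<in> r \<longleftrightarrow> G q \<subseteq> B"
        proof (cases "(q, a) \<in> r")
          case True
          then show ?thesis using Gord[OF q aT] B(2) ord(1)[OF ql] by auto
        next
          case False
          then have "q \<in> N" using q by (simp add: N_def)
          then show ?thesis using x B(3) False ord(1)[OF ql] by blast
        qed
        show "(l, q) \<in> r \<longleftrightarrow> B \<subseteq> G q" using ord(2)[OF ql] B(4) q by (auto simp: Y_def)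
      next
        \<comment> \<open>Vacuous: nothing other than \<open>l\<close> lies above
          \<open>l\<close>.\<close>
        show "(l, m) \<in> r \<Longrightarrow> B \<subseteq> W" using ord(2)[of m] l by simp
        have "W \<subseteq> Y" by (auto simp: W_def Y_def D)
        then show "\<not> B \<subseteq> W" using B(4) by blast
      qed (use B in blast)
    next
      assume cov: "(l, a) \<in> covers r"
      note ord = leaf_below_neighbour[OF fin po leaf cov]
      have lk: "1 \<le> \<rho> l" "\<rho> l < \<rho> a" "\<rho> a \<le> k"
        using less.prems(4)[OF lTm] less.prems(4)[OF aTm] less.prems(5)[OF lTm aTm] cov
        by (auto simp: covers_def)
      have lma: "(l, m) \<in> r \<longleftrightarrow> (a, m) \<in> r" using ord(1)[of m] l by simp
      \<comment> \<open>Each \<open>q\<close> not above \<open>a\<close> has a witness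
        \<open>x q\<close> in \<open>G a - G q\<close>; keeping it in \<open>B\<close> prevents
        \<open>B \<subseteq> G q\<close>.\<close>
      define N where "N = {q \<in> T' - {m}. (a, q) \<notin> r}"
      have "\<forall>q\<in>N. \<exists>x. x \<in> G a - G q" using Gord aT by (auto simp: N_def)
      then obtain x where x: "\<And>q. q \<in> N \<Longrightarrow> x q \<in> G a - G q" by (meson bchoice)
      have finN: "finite N" using finT' by (simp add: N_def)
      \<comment> \<open>If \<open>a\<close> is not below \<open>m\<close>, the induction hypothesis
        gives an element of \<open>G a\<close> outside \<open>W\<close>, and keeping it makes
        \<open>B\<close> leave \<open>W\<close>. If \<open>a\<close> is below \<open>m\<close>, any
        element of \<open>G a\<close> will do; a proper subset obtained from \<open>down\<close>
        shows that there is one.\<close>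
      have "\<exists>w\<in>G a. (a, m) \<notin> r \<longrightarrow> w \<notin> W"
      proof (cases "(a, m) \<in> r")
        case True
        have "\<exists>B\<in>R (\<rho> l). B \<subset> G a \<and> {} \<subseteq> B \<and> \<not> G a \<subseteq> B \<union> {}"
          using lk by (intro down[OF G[OF aT]]) auto
        with True show ?thesis by blast
      next
        case False
        then have "\<not> G a \<subseteq> W" unfolding W_def D_def
          using T'T by (intro Gdown) (auto simp: down_set_def r'_def)
        then show ?thesis by blast
      qed
      then obtain w where w: "w \<in> G a" "(a, m) \<notin> r \<Longrightarrow> w \<notin> W" by blast
      \<comment> \<open>An element of \<open>G a\<close> outside \<open>Y\<close> lies in every
        \<open>G q\<close>. Since \<open>B\<close> lacks such an element, no \<open>G q\<close> is
        contained in \<open>B\<close>.\<close>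
      define Y where "Y = (\<Union>q\<in>T' - {m}. G a - G q)"
      have "card (insert w (x ` N)) \<le> Suc (card (x ` N))" by (rule card_insert_le_m1) auto
      also have "\<dots> \<le> Suc (card N)" using finN by (simp add: card_image_le)
      also have "\<dots> \<le> Suc (card T')" using finT' by (intro Suc_le_mono[THEN iffD2] card_mono) (auto simp: N_def)
      finally have Z: "insert w (x ` N) \<subseteq> G a" "card (insert w (x ` N)) \<le> K"
        using x w cK by auto
      have "G a \<inter> Y = Y" by (auto simp: Y_def)
      then have cY: "card (G a \<inter> Y) \<le> 2 * K * K * s"
        unfolding Y_def 
        using cUn[of "\<lambda>q. G a - G q"] dist[OF aT] by (simp only:)
      from down[OF G[OF aT] lk Z cY] obtain B where
        B: "B \<in> R (\<rho> l)" "B \<subset> G a" "insert w (x ` N) \<subseteq> B" "\<not> G a \<subseteq> B \<union> Y" by blast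
      show ?thesis
      proof (rule finish[OF B(1)])
        fix q assume q: "q \<in> T' - {m}"
        then have ql: "q \<noteq> l" by (auto simp: T'_def)
        show "(q, l) \<in> r \<longleftrightarrow> G q \<subseteq> B" using ord(2)[OF ql] B(4) q by (auto simp: Y_def)
        show "(l, q) \<in> r \<longleftrightarrow> B \<subseteq> G q"
        proof (cases "(a, q) \<in> r")
          case True
          then show ?thesis using Gord[OF aT q] B(2) ord(1)[OF ql] by auto
        next
          case False
          then have "q \<in> N" using q by (simp add: N_def)
          then show ?thesis using x B(3) False ord(1)[OF ql] by blast
        qed
      next
        assume "(l, m) \<in> r"
        then have "a \<in> D - {m}" using lma aT by (auto simp: D)
        then show "B \<subseteq> W" using B(2) by (auto simp: W_def)
      next
        assume "(l, m) \<notin> r"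
        then show "\<not> B \<subseteq> W" using lma w(2) B(3) by blast
      qed (use B in blast)
    qed
  qed
qed

end

section \<open>Families in the middle layers\<close>

text \<open>The rank of \<open>p\<close> is the largest size of a chain that avoids \<open>m\<close>
  and has \<open>p\<close> on top. Chains avoiding \<open>m\<close> have at most \<open>k\<close>
  elements, since those of size \<open>k + 1\<close> all contain \<open>m\<close>.\<close>

lemma ex_rank_function:
  assumes fin: "finite T" and po: "partial_order_on T r" and ht: "height r = k + 1"
    and chains: "\<And>C. C \<in> Chains r \<Longrightarrow> card C = k + 1 \<Longrightarrow> m \<in> C"
  shows "\<exists>\<rho>. (\<forall>p\<in>T - {m}. \<rho> p \<in> {1..k}) \<and>
    (\<forall>p\<in>T - {m}. \<forall>q\<in>T - {m}. (p, q) \<in> r \<longrightarrow> p \<noteq> q \<longrightarrow> \<rho> p < \<rho> q)"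
proof -
  note po' = partial_order_onD[OF po]
  have sub: "Chains r \<subseteq> Pow T" using po'(4) by (auto simp: Chains_def)
  then have finC: "finite (Chains r)" using fin by (simp add: finite_subset)
  define S where "S p = {C \<in> Chains r. m \<notin> C \<and> p \<in> C \<and> (\<forall>q\<in>C. (q, p) \<in> r)}" for p
  define \<rho> where "\<rho> p = Max (card ` S p)" for p
  have finS: "finite (S p)" for p using finC by (simp add: S_def)
  have single: "{p} \<in> S p" if "p \<in> T - {m}" for p
    using that po'(1) by (auto simp: S_def Chains_def refl_on_def)
  have le: "card C \<le> k" if C: "C \<in> Chains r" "m \<notin> C" for C
  proof -
    have "card C \<le> height r" unfolding height_def using finC C by (intro Max_ge) auto
    moreover have "card C \<noteq> k + 1" using chains C by blast
    ultimately show ?thesis using ht by simp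
  qed
  have att: "\<exists>C\<in>S p. card C = \<rho> p" if "p \<in> T - {m}" for p
  proof -
    have "\<rho> p \<in> card ` S p" unfolding \<rho>_def using finS single[OF that] by (intro Max_in) auto
    then show ?thesis by force
  qed
  have "\<rho> p \<in> {1..k}" if p: "p \<in> T - {m}" for p
  proof -
    have "card {p} \<le> \<rho> p" unfolding \<rho>_def using finS single[OF p] by (intro Max_ge) blast+
    moreover obtain C where "C \<in> S p" "card C = \<rho> p" using att[OF p] by blast
    then have "\<rho> p \<le> k" using le[of C] by (simp add: S_def)
    ultimately show ?thesis by simp
  qed
  moreover have "\<rho> p < \<rho> q" if p: "p \<in> T - {m}" and q: "q \<in> T - {m}" and pq: "(p, q) \<in> r" "p \<noteq> q" for p q
  proof -
    obtain C where C: "C \<in> S p" "card C = \<rho> p" using att[OF p] by blast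
    have below: "(x, q) \<in> r" if "x \<in> C" for x
      using C(1) that pq po'(2) by (auto simp: S_def dest: transD)
    have "q \<notin> C"
    proof
      assume "q \<in> C"
      then have "(q, p) \<in> r" using C(1) by (auto simp: S_def)
      then show False using pq po'(3) by (auto dest: antisymD)
    qed
    moreover have "finite C" using C(1) sub fin by (auto simp: S_def intro: finite_subset)
    moreover have "insert q C \<in> S q"
      using C(1) below q po'(1) by (auto simp: S_def Chains_def refl_on_def)
    then have "card (insert q C) \<le> \<rho> q" unfolding \<rho>_def using finS by (intro Max_ge) auto
    ultimately show ?thesis using C(2) by simp
  qed
  ultimately show ?thesis by blast
qed

text \<open>Pigeonhole over the \<open>n + 1\<close> levels; sets of equal size are
  incomparable.\<close>

lemma ex_large_level:
  assumes F: "\<F> \<subseteq> Pow {1..n}" and large: "t * (n + 1) < card \<F>"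
  shows "\<exists>\<A>\<subseteq>\<F>. card \<A> = t \<and> (\<forall>A\<in>\<A>. \<forall>B\<in>\<A>. A \<subseteq> B \<longrightarrow> A = B)"
proof -
  define L where "L i = {A \<in> \<F>. card A = i}" for i
  have finF: "finite \<F>" using F by (rule finite_subset) simp
  have "\<exists>i. t < card (L i)"
  proof (rule ccontr)
    assume "\<not> (\<exists>i. t < card (L i))"
    then have le: "card (L i) \<le> t" for i by (simp add: not_less)
    have "card A \<le> n" if "A \<in> \<F>" for A using F that card_mono[of "{1..n}" A] by auto
    then have "\<F> = (\<Union>i\<in>{..n}. L i)" by (auto simp: L_def)
    then have "card \<F> \<le> (\<Sum>i\<in>{..n}. card (L i))" using card_UN_le[of "{..n}" L] by simp
    also have "\<dots> \<le> (\<Sum>i\<in>{..n}. t)" by (intro sum_mono le)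
    finally show False using large by (simp add: mult.commute)
  qed
  then obtain i where i: "t < card (L i)" by blast
  then obtain \<A> where \<A>: "\<A> \<subseteq> L i" "card \<A> = t"
    using obtain_subset_with_card_n[of t "L i"] by (metis less_imp_le)
  have "A = B" if "A \<in> \<A>" "B \<in> \<A>" "A \<subseteq> B" for A B
  proof -
    have "B \<subseteq> {1..n}" "card A = card B" using that \<A> F by (auto simp: L_def)
    then show ?thesis using that card_subset_eq[of B A] finite_subset[of B "{1..n}"] by simp
  qed
  then show ?thesis using \<A> by (intro exI[of _ \<A>]) (auto simp: L_def)
qed

lemma eventually_sqrt_ln_less:
  fixes c :: real
  assumes "c > 0"
  shows "eventually (\<lambda>n::nat. sqrt (real n * ln (real n)) < c * real n) sequentially"
proof -
  have "((\<lambda>n::nat. sqrt (real n * ln (real n)) / real n) \<longlongrightarrow> 0) sequentially"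
    by real_asymp
  then have "eventually (\<lambda>n::nat. sqrt (real n * ln (real n)) / real n < c) sequentially"
    using assms by (rule order_tendstoD)
  then show ?thesis
    using eventually_gt_at_top[of 0] by eventually_elim (simp add: field_simps)
qed

text \<open>The central coefficient is at least \<open>n choose 2\<close>, which is already
  quadratic.\<close>

lemma eventually_binomial_large:
  fixes c t :: real
  assumes "c > 0"
  shows "eventually (\<lambda>n::nat. t * (real n + 1) < c * real (n choose (n div 2))) sequentially"
proof -
  have "eventually (\<lambda>n::nat. t * (real n + 1) < c * (real n * (real n - 1) / 2)) sequentially"
    using assms by real_asymp
  then show ?thesis
  proof eventually_elim
    case (elim n)
    have eq: "real (n choose 2) = real n * (real n - 1) / 2"
      by (cases n) (simp_all add: choose_two real_of_nat_div algebra_simps)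
    have "real (n choose 2) \<le> real (n choose (n div 2))"
      using binomial_maximum[of n 2] by simp
    then have "c * real (n choose 2) \<le> c * real (n choose (n div 2))"
      using assms by (intro mult_left_mono) auto
    with elim show ?case unfolding eq[symmetric] by (rule less_le_trans)
  qed
qed

text \<open>Two sets of the middle layers differ in size by at most
  \<open>4 * sqrt (n * ln n)\<close>, and \<open>s\<close> is the floor of this. The hypothesis
  \<open>small\<close> is the worst case of the union bounds in the extension steps, with
  \<open>n / 4\<close> as lower bound for the sizes of \<open>A\<close> and of its
  complement.\<close>

lemma extendable_rich:
  fixes s K :: nat
  assumes S: "S \<subseteq> middle_layers n \<times> {1..k}" and rich: "\<And>x. x \<in> S \<Longrightarrow> rich n k \<delta> S x"
    and \<delta>: "\<delta> > 0"
    and s: "s = nat \<lfloor>4 * sqrt (real n * ln (real n))\<rfloor>"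
    and quarter: "sqrt (real n * ln (real n)) \<le> real n / 8"
    and small: "real (K * s + 2 * K * K * s) < \<delta> * (real n / 4)"
  shows "extendable (\<lambda>i. {A. (A, i) \<in> S}) k s K"
proof -
  have mid: "A \<subseteq> {1..n}" "\<bar>real (card A) - real n / 2\<bar> \<le> 2 * sqrt (real n * ln (real n))"
    if "(A, i) \<in> S" for A i
    using that S by (auto simp: middle_layers_def)
  have close: "card A \<le> card B + s" if "(A, i) \<in> S" "(B, j) \<in> S" for A B i j
  proof -
    have "real (card A) - real (card B) \<le> 4 * sqrt (real n * ln (real n))"
      using mid(2)[OF that(1)] mid(2)[OF that(2)] by linarith
    then have "int (card A) - int (card B) \<le> \<lfloor>4 * sqrt (real n * ln (real n))\<rfloor>"
      by (simp add: le_floor_iff)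
    then show ?thesis using s by linarith
  qed
  \<comment> \<open>By \<open>quarter\<close>, \<open>card A\<close> is within \<open>n / 4\<close>
    of \<open>n / 2\<close>.\<close>
  have bounds: "\<delta> * (real n / 4) \<le> \<delta> * real (card A)" "\<delta> * (real n / 4) \<le> \<delta> * real (n - card A)"
    if "(A, i) \<in> S" for A i
  proof -
    have "card A \<le> n" using card_mono[OF _ mid(1)[OF that]] by simp
    then show "\<delta> * (real n / 4) \<le> \<delta> * real (card A)" "\<delta> * (real n / 4) \<le> \<delta> * real (n - card A)"
      using mid(2)[OF that] quarter \<delta> by (auto simp: of_nat_diff abs_le_iff)
  qed
  have less: "real (z * s + y) < \<delta> * (real n / 4)" if "z \<le> K" "y \<le> 2 * K * K * s" for z y
  proof -
    have "z * s + y \<le> K * s + 2 * K * K * s" using that by (intro add_mono mult_le_mono1)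
    then show ?thesis using small by (smt (verit) of_nat_le_iff)
  qed
  show ?thesis
  proof
    show "finite A" if "A \<in> {A. (A, i) \<in> S}" for A i
      using that mid(1) by (auto intro: finite_subset)
    show "card A \<le> card B + s" if "A \<in> {A. (A, i) \<in> S}" "B \<in> {A. (A, j) \<in> S}" for A B i j
      using that close by blast
    show "\<exists>B\<in>{A. (A, i) \<in> S}. A \<subset> B \<and> B \<inter> Z = {} \<and> \<not> B \<subseteq> A \<union> Y"
      if "A \<in> {A. (A, j) \<in> S}" "j < i" "i \<le> k" "finite Z" "Z \<inter> A = {}" "card Z \<le> K" "finite Y"
        "card (Y - A) \<le> 2 * K * K * s" for A j i Z Y
    proof -
      note prems = that
      have A: "(A, j) \<in> S" using prems(1) by simp
      have "real (card Z * s + card (Y - A)) < \<delta> * real (n - card A)"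
        using less[OF prems(6,8)] bounds(2)[OF A] by linarith
      moreover have "B \<subseteq> {1..n} \<and> card B \<le> card A + s" if "(B, i) \<in> S" for B
        using mid(1)[OF that] close[OF that A] by blast
      ultimately obtain B where "(B, i) \<in> S" "A \<subset> B" "B \<inter> Z = {}" "\<not> B \<subseteq> A \<union> Y"
        using rich_extend_up[OF rich[OF A] mid(1)[OF A] prems(2,3) _ prems(4,5,7)] by metis
      then show ?thesis by blast
    qed
    show "\<exists>B\<in>{A. (A, i) \<in> S}. B \<subset> A \<and> Z \<subseteq> B \<and> \<not> A \<subseteq> B \<union> Y"
      if "A \<in> {A. (A, j) \<in> S}" "1 \<le> i" "i < j" "j \<le> k" "Z \<subseteq> A" "card Z \<le> K"
        "card (A \<inter> Y) \<le> 2 * K * K * s" for A j i Z Y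
    proof -
      note prems = that
      have A: "(A, j) \<in> S" using prems(1) by simp
      have "real (card Z * s + card (A \<inter> Y)) < \<delta> * real (card A)"
        using less[OF prems(6,7)] bounds(1)[OF A] by linarith
      moreover have "card A \<le> card B + s" if "(B, i) \<in> S" for B
        using close[OF A that] .
      ultimately obtain B where "(B, i) \<in> S" "B \<subset> A" "Z \<subseteq> B" "\<not> A \<subseteq> B \<union> Y"
        using rich_extend_down[OF rich[OF A] mid(1)[OF A] prems(3,2,4) _ prems(5)] by metis
      then show ?thesis by blast
    qed
  qed
qed

text \<open>Richness at any pair makes rank 1 hit with positive probability. This supplies the
  common reference set of the embedding.\<close>

lemma rich_rank_1_nonempty:
  assumes S: "S \<subseteq> \<F> \<times> {1..k}" "S \<noteq> {}" and rich: "\<And>x. x \<in> S \<Longrightarrow> rich n k \<delta> S x"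
    and F: "\<F> \<subseteq> Pow {1..n}" and \<delta>: "\<delta> > 0" and k: "k \<ge> 1"
  shows "\<exists>A. (A, 1) \<in> S"
proof -
  obtain A j where A: "(A, j) \<in> S" using S(2) by auto
  show ?thesis
  proof (cases "j = 1")
    case False
    have "A \<subseteq> {1..n}" using A S F by blast
    then have "0 < \<delta> * real (card (through n A))"
      using \<delta> card_through_pos by simp
    also have "\<dots> \<le> real (card (hits n A (side S A j 1)))"
      using rich[OF A] False k by (auto simp: rich_def)
    finally have "hits n A (side S A j 1) \<noteq> {}" by auto
    then show ?thesis by (auto simp: hits_def side_def)
  qed (use A in auto)
qed

text \<open>By connectedness every \<open>p\<close> other than \<open>m\<close> has a Hasse
  neighbour, which can only be \<open>m\<close> when \<open>T - {m}\<close> is an antichain. This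
  makes the union condition vacuous for \<open>k \<le> 1\<close>.\<close>

lemma tree_poset_all_below:
  assumes tp: "tree_poset T r" and max: "maximal_in T r m"
    and anti: "\<And>p q. p \<in> T - {m} \<Longrightarrow> q \<in> T - {m} \<Longrightarrow> (p, q) \<in> r \<Longrightarrow> p = q"
  shows "down_set T r m = T"
proof -
  have po: "partial_order_on T r" and tree: "is_tree T (hasse r)"
    using tp by (auto simp: tree_poset_def)
  note po' = partial_order_onD[OF po]
  have m: "m \<in> T" "\<And>q. (m, q) \<in> r \<Longrightarrow> q = m"
    using max po'(4) by (auto simp: maximal_in_def)
  have "(p, m) \<in> r" if p: "p \<in> T" "p \<noteq> m" for p
  proof -
    have "(p, m) \<in> (hasse r)\<^sup>*" using tree p m by (auto simp: is_tree_def)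
    then obtain y where y: "(p, y) \<in> hasse r" using p(2) by (auto elim: converse_rtranclE)
    then have "y \<in> T" "y \<noteq> p" "(p, y) \<in> r \<or> (y, p) \<in> r"
      using po'(4) by (auto simp: hasse_def covers_def)
    then show ?thesis using anti[of p y] anti[of y p] p m by (cases "y = m") auto
  qed
  then show ?thesis using m(1) po'(1) by (auto simp: down_set_def refl_on_def)
qed

section \<open>Assembly of the cases \<open>k = 0\<close>, \<open>k = 1\<close> and
  \<open>k \<ge> 2\<close>\<close>

theorem theorem2p1:
  fixes T :: "'a set" and r :: "'a rel" and m :: 'a and k :: nat and \<epsilon> :: real
  assumes "tree_poset T r"
    and "height r = k + 1"
    and "maximal_in T r m"
    and "\<And>C. C \<in> Chains r \<Longrightarrow> card C = k + 1 \<Longrightarrow> m \<in> C"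
    and "\<epsilon> > 0"
  shows "\<exists>n\<^sub>0::nat. \<forall>n\<ge>n\<^sub>0. \<forall>\<F>. \<F> \<subseteq> middle_layers n
           \<and> real (card \<F>) = (real k - 1 + \<epsilon>) * real (n choose (n div 2))
         \<longrightarrow> (\<exists>\<G> G. \<G> \<subseteq> \<F>
               \<and> strong_copy G (T - {m}) (Restr r (T - {m})) \<G>
               \<and> (\<forall>p \<in> T - down_set T r m.
                     \<not> G p \<subseteq> (\<Union>d \<in> down_set T r m - {m}. G d)))"
proof -
  have fin: "finite T" and po: "partial_order_on T r" using assms(1) by (auto simp: tree_poset_def)
  note po' = partial_order_onD[OF po]
  obtain \<rho> where \<rho>: "\<And>p. p \<in> T - {m} \<Longrightarrow> \<rho> p \<in> {1..k}"
    and \<rho>_mono: "\<And>p q. p \<in> T - {m} \<Longrightarrow> q \<in> T - {m} \<Longrightarrow> (p, q) \<in> r \<Longrightarrow> p \<noteq> q \<Longrightarrow> \<rho> p < \<rho> q"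
    using ex_rank_function[OF fin po assms(2,4)] by auto
  \<comment> \<open>Equivalence of order and inclusion already forces injectivity, by
    antisymmetry.\<close>
  have copy: "\<exists>\<G> G. \<G> \<subseteq> \<F> \<and> strong_copy G (T - {m}) (Restr r (T - {m})) \<G>
      \<and> (\<forall>p\<in>T - down_set T r m. \<not> G p \<subseteq> (\<Union>d\<in>down_set T r m - {m}. G d))"
    if "\<And>p. p \<in> T - {m} \<Longrightarrow> G p \<in> \<F>"
      and ord: "\<And>p q. p \<in> T - {m} \<Longrightarrow> q \<in> T - {m} \<Longrightarrow> (p, q) \<in> r \<longleftrightarrow> G p \<subseteq> G q"
      and "\<forall>p\<in>T - down_set T r m. \<not> G p \<subseteq> (\<Union>d\<in>down_set T r m - {m}. G d)"
    for G and \<F> :: "nat set set"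
  proof (intro exI conjI)
    have "inj_on G (T - {m})"
      using ord po'(3) by (intro inj_onI) (metis antisymD order_refl)
    then show "strong_copy G (T - {m}) (Restr r (T - {m})) (G ` (T - {m}))"
      using ord by (auto simp: strong_copy_def bij_betw_def)
  qed (use that in auto)
  consider "k = 0" | "k = 1" | "2 \<le> k" by linarith
  then show ?thesis
  proof cases
    case 1
    \<comment> \<open>There are no ranks, so \<open>T\<close> consists of \<open>m\<close> alone and
      the copy is empty.\<close>
    then have "T - {m} = {}" using \<rho> by fastforce
    moreover from this have "down_set T r m = T" by (intro tree_poset_all_below assms) auto
    ultimately have "\<exists>\<G> G. \<G> \<subseteq> \<F> \<and> strong_copy G (T - {m}) (Restr r (T - {m})) \<G>
      \<and> (\<forall>p\<in>T - down_set T r m. \<not> G p \<subseteq> (\<Union>d\<in>down_set T r m - {m}. G d))" for \<F> :: "nat set set"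
      by (intro copy[of "\<lambda>_. {}"]) auto
    then show ?thesis by blast
  next
    case 2
    have anti: "p = q" if "p \<in> T - {m}" "q \<in> T - {m}" "(p, q) \<in> r" for p q
      using \<rho>_mono[OF that] \<rho>[OF that(1)] \<rho>[OF that(2)] 2 by force
    have down: "down_set T r m = T" using anti by (intro tree_poset_all_below assms) auto
    define t where "t = card (T - {m})"
    from eventually_binomial_large[OF assms(5), of "real t"] obtain n0 where
      n0: "\<And>n. n \<ge> n0 \<Longrightarrow> real t * (real n + 1) < \<epsilon> * real (n choose (n div 2))"
      by (auto simp: eventually_sequentially)
    show ?thesis
    proof (intro exI[of _ n0] allI impI)
      fix n \<F>
      assume n: "n0 \<le> n" and F: "\<F> \<subseteq> middle_layers n \<and>
        real (card \<F>) = (real k - 1 + \<epsilon>) * real (n choose (n div 2))"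
      then have "real (t * (n + 1)) < real (card \<F>)"
        using n0[OF n] 2 by (simp add: algebra_simps)
      then have "t * (n + 1) < card \<F>" by (simp only: of_nat_less_iff)
      moreover have "\<F> \<subseteq> Pow {1..n}" using F by (auto simp: middle_layers_def)
      ultimately obtain \<A> where \<A>: "\<A> \<subseteq> \<F>" "card \<A> = t"
        "\<And>A B. A \<in> \<A> \<Longrightarrow> B \<in> \<A> \<Longrightarrow> A \<subseteq> B \<Longrightarrow> A = B"
        using ex_large_level[of \<F> n t] by blast
      have "finite \<A>" using \<A>(1) \<open>\<F> \<subseteq> Pow {1..n}\<close> by (auto intro: finite_subset)
      then obtain G where G: "bij_betw G (T - {m}) \<A>"
        using finite_same_card_bij[of "T - {m}" \<A>] fin \<A>(2) by (auto simp: t_def)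
      show "\<exists>\<G> G. \<G> \<subseteq> \<F> \<and> strong_copy G (T - {m}) (Restr r (T - {m})) \<G>
        \<and> (\<forall>p\<in>T - down_set T r m. \<not> G p \<subseteq> (\<Union>d\<in>down_set T r m - {m}. G d))"
      proof (rule copy)
        show "G p \<in> \<F>" if "p \<in> T - {m}" for p using G \<A>(1) that by (auto simp: bij_betw_def)
        show "(p, q) \<in> r \<longleftrightarrow> G p \<subseteq> G q" if pq: "p \<in> T - {m}" "q \<in> T - {m}" for p q
        proof
          assume "(p, q) \<in> r"
          then show "G p \<subseteq> G q" using anti[OF pq] by simp
        next
          assume "G p \<subseteq> G q"
          then have "G p = G q" using \<A>(3) G pq by (auto simp: bij_betw_def)
          then have "p = q" using G pq by (auto simp: bij_betw_def inj_on_def)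
          then show "(p, q) \<in> r" using pq po'(1) by (auto simp: refl_on_def)
        qed
      qed (simp add: down)
    qed
  next
    case 3
    define K where "K = card T + 1"
    define c where "c = real k - 1 + \<epsilon>"
    \<comment> \<open>Chosen so that \<open>k * \<delta> * c = \<epsilon> / 2\<close>: half of the
      surplus \<open>\<epsilon>\<close> pays for the exceptional events and the other half keeps the
      count above \<open>k - 1\<close>.\<close>
    define \<delta> where "\<delta> = \<epsilon> / (2 * real k * c)"
    have c: "c > 0" using 3 assms(5) by (simp add: c_def)
    have \<delta>: "\<delta> > 0" using c 3 assms(5) by (simp add: \<delta>_def)
    have k\<delta>: "(1 - real k * \<delta>) * c = real k - 1 + \<epsilon> / 2" and k\<delta>1: "1 - real k * \<delta> \<ge> 0"
    proof -
      have k\<delta>c: "real k * \<delta> * c = \<epsilon> / 2" using c 3 by (simp add: \<delta>_def)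
      then show eq: "(1 - real k * \<delta>) * c = real k - 1 + \<epsilon> / 2"
        by (simp add: algebra_simps c_def)
      then have "(1 - real k * \<delta>) * c > 0" using 3 assms(5) by simp
      then show "1 - real k * \<delta> \<ge> 0" using c by (simp add: zero_less_mult_iff)
    qed
    \<comment> \<open>\<open>C * s\<close> is the number of forbidden pairs to be afforded. With
      \<open>s\<close> at most \<open>4 * sqrt (n * ln n)\<close>, the factor \<open>16\<close>
      below brings it under \<open>\<delta> * n / 4\<close>.\<close>
    define C where "C = real (K + 2 * K * K)"
    have C: "C > 0" unfolding C_def of_nat_0_less_iff by (simp add: K_def)
    have "eventually (\<lambda>n::nat. sqrt (real n * ln (real n)) < (1 / 8) * real n) sequentially"
      "eventually (\<lambda>n::nat. sqrt (real n * ln (real n)) < (\<delta> / (16 * C)) * real n) sequentially"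
      using \<delta> C by (intro eventually_sqrt_ln_less; simp)+
    then have "eventually (\<lambda>n::nat. sqrt (real n * ln (real n)) < (1 / 8) * real n \<and>
        sqrt (real n * ln (real n)) < (\<delta> / (16 * C)) * real n) sequentially"
      by (rule eventually_conj)
    then obtain n0 where n0: "\<And>n. n \<ge> n0 \<Longrightarrow> sqrt (real n * ln (real n)) < (1 / 8) * real n \<and>
        sqrt (real n * ln (real n)) < (\<delta> / (16 * C)) * real n"
      by (auto simp: eventually_sequentially)
    show ?thesis
    proof (intro exI[of _ n0] allI impI)
      fix n \<F>
      assume n: "n0 \<le> n" and F': "\<F> \<subseteq> middle_layers n \<and>
        real (card \<F>) = (real k - 1 + \<epsilon>) * real (n choose (n div 2))"
      then have F: "\<F> \<subseteq> Pow {1..n}" by (auto simp: middle_layers_def)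
      define b where "b = real (n choose (n div 2))"
      have b: "b > 0" by (simp add: b_def)
      have "c = real (card \<F>) * (1 / b)" using F' b by (simp add: b_def c_def)
      also have "\<dots> = (\<Sum>A\<in>\<F>. 1 / b)" by simp
      \<comment> \<open>The central binomial coefficient is the largest, so a set of any size
        contributes at least \<open>1 / b\<close>.\<close>
      also have "\<dots> \<le> (\<Sum>A\<in>\<F>. 1 / real (n choose card A))"
      proof (rule sum_mono)
        fix A assume "A \<in> \<F>"
        then have "card A \<le> n" using F card_mono[of "{1..n}" A] by auto
        then show "1 / b \<le> 1 / real (n choose card A)"
          using binomial_maximum[of n "card A"] by (intro divide_left_mono) (auto simp: b_def)
      qed
      finally have "(1 - real k * \<delta>) * c \<le> (1 - real k * \<delta>) * (\<Sum>A\<in>\<F>. 1 / real (n choose card A))"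
        using k\<delta>1 by (rule mult_left_mono)
      then have "real k - 1 < (1 - real k * \<delta>) * (\<Sum>A\<in>\<F>. 1 / real (n choose card A))"
        using k\<delta> assms(5) by linarith
      moreover have "1 \<le> k" using 3 by simp
      ultimately obtain S where S: "S \<subseteq> \<F> \<times> {1..k}" "S \<noteq> {}" "\<And>x. x \<in> S \<Longrightarrow> rich n k \<delta> S x"
        using ex_rich_system[OF F, of k \<delta>] by blast
      define s where "s = nat \<lfloor>4 * sqrt (real n * ln (real n))\<rfloor>"
      have "real s \<le> 4 * sqrt (real n * ln (real n))" 
        unfolding s_def by (rule of_nat_floor) (cases "n = 0"; simp)
      then have "real s * C < (4 * (\<delta> / (16 * C)) * real n) * C"
        using n0[OF n] C by (intro mult_strict_right_mono) auto
      also have "\<dots> = \<delta> * (real n / 4)" using C by simp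
      also have "real s * C = real (K * s + 2 * K * K * s)" by (simp add: C_def algebra_simps)
      finally have small: "real (K * s + 2 * K * K * s) < \<delta> * (real n / 4)" .
      interpret extendable "\<lambda>i. {A. (A, i) \<in> S}" k s K
        using S F' n0[OF n] by (intro extendable_rich[OF _ S(3) \<delta> s_def _ small]) auto
      obtain A0 where A0: "(A0, 1) \<in> S"
        using rich_rank_1_nonempty[OF S F \<delta>] 3 by auto
      then have A0': "A0 \<in> {A. (A, 1) \<in> S}" by simp
      have cT: "card T < K" by (simp add: K_def)
      have "\<exists>G. (\<forall>p\<in>T - {m}. G p \<in> {A. (A, \<rho> p) \<in> S} \<and> near (Suc (card T)) (G p) A0) \<and>
          (\<forall>p\<in>T - {m}. \<forall>q\<in>T - {m}. (p, q) \<in> r \<longleftrightarrow> G p \<subseteq> G q) \<and>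
          (\<forall>p\<in>T - down_set T r m. \<not> G p \<subseteq> (\<Union>d\<in>down_set T r m - {m}. G d))"
        by (rule ex_embedding[OF 3 A0' assms(1,3) cT]) (fact \<rho>, fact \<rho>_mono)
      then show "\<exists>\<G> G. \<G> \<subseteq> \<F> \<and> strong_copy G (T - {m}) (Restr r (T - {m})) \<G>
        \<and> (\<forall>p\<in>T - down_set T r m. \<not> G p \<subseteq> (\<Union>d\<in>down_set T r m - {m}. G d))"
      proof (elim exE conjE)
        fix G
        assume G: "\<forall>p\<in>T - {m}. G p \<in> {A. (A, \<rho> p) \<in> S} \<and> near (Suc (card T)) (G p) A0"
          and ord: "\<forall>p\<in>T - {m}. \<forall>q\<in>T - {m}. (p, q) \<in> r \<longleftrightarrow> G p \<subseteq> G q"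
          and down: "\<forall>p\<in>T - down_set T r m. \<not> G p \<subseteq> (\<Union>d\<in>down_set T r m - {m}. G d)"
        show "\<exists>\<G> G. \<G> \<subseteq> \<F> \<and> strong_copy G (T - {m}) (Restr r (T - {m})) \<G>
          \<and> (\<forall>p\<in>T - down_set T r m. \<not> G p \<subseteq> (\<Union>d\<in>down_set T r m - {m}. G d))"
        proof (rule copy[OF _ _ down])
          show "G p \<in> \<F>" if "p \<in> T - {m}" for p using G that S(1) by blast
          show "(p, q) \<in> r \<longleftrightarrow> G p \<subseteq> G q" if "p \<in> T - {m}" "q \<in> T - {m}" for p q
            using ord that by simp
        qed
      qed
    qed
  qed
qed

end
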